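(* Let $A:\{0,1\}^n\times S\rightarrow\{0,1\}$ be a classical probabilistic algorithm that $(0,q)$-computes some function $f:\{0,1\}^n\to\{0,1\}$, let $N=|S|$ and let $\varepsilon\geq 2^{-N}$. Then, given a black-box for $A$, the number of calls to $A$ that are necessary and sufficient for a quantum algorithm to $(0,1-\varepsilon)$-compute $f$ is $$\Theta\left(\sqrt{N}\left(\sqrt{\log(1/\varepsilon)+qN}-\sqrt{qN}\right)\right).$$
   Context: A classical probabilistic algorithm $A$ is viewed as a deterministic algorithm with an auxiliary random input $r$ drawn uniformly from a finite sample space $S$. For $0\le p<q\le 1$, an algorithm (classical or quantum) $(p,q)$-computes $f$ if on every input $x$ its acceptance probability (probability of outputting 1) is $\le p$ when $f(x)=0$ and $\ge q$ when $f(x)=1$. A "$(0,q)$"-computer is thus a one-sided-error algorithm: $f(x)=1$ iff $A(x,r)=1$ for at least a $q$ fraction of $r\in S$ (and $f(x)=0$ iff $A(x,r)=0$ for all $r$). "Given a black-box for $A$" means the quantum algorithm accesses $A$ only via a query (oracle) gate $|r,b\rangle\mapsto|r,b\oplus A(x,r)\rangle$ for $r\in S$, $b\in\{0,1\}$, interleaved with input-independent unitaries; each application of this gate counts as one call to $A$.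
   Formalization: Necessity is proved for q ≤ η and sufficiency for ε ≤ δ, for any fixed η, δ < 1, with constants depending on them; uniformly the claim fails (q=1, ε=2^-N: one call suffices; ε→1: bound tends to 0 but a call is needed). S is a finite set of naturals; the algorithm must work for every A. *)

theory Defs
  imports "HOL-Analysis.Analysis"
begin

text \<open>
  An input in $\{0,1\}^n$ is a boolean list of length $n$. The argument \<open>P x\<close> is the
  probability that the algorithm under consideration, classical or quantum, outputs 1 on \<open>x\<close>.
\<close>

definition pq_computes ::
  "real \<Rightarrow> real \<Rightarrow> nat \<Rightarrow> (bool list \<Rightarrow> real) \<Rightarrow> (bool list \<Rightarrow> bool) \<Rightarrow> bool" where
  "pq_computes p q n P f \<longleftrightarrow>
     (\<forall>x. length x = n \<longrightarrow> (\<not> f x \<longrightarrow> P x \<le> p) \<and> (f x \<longrightarrow> q \<le> P x))"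

definition classical_acceptance ::
  "'r set \<Rightarrow> (bool list \<Rightarrow> 'r \<Rightarrow> bool) \<Rightarrow> bool list \<Rightarrow> real" where
  "classical_acceptance S A x = real (card {r \<in> S. A x r}) / real (card S)"

text \<open>
  The computational basis states are \<open>(r, b, w)\<close>: a query register \<open>r \<in> S\<close>, an answer bit \<open>b\<close>
  and a workspace register \<open>w < m\<close>. States and operators are given by their coordinates; only
  coordinates in \<open>basis S m\<close> are meaningful.
\<close>

type_synonym 'r label = "'r \<times> bool \<times> nat"
type_synonym 'r state = "'r label \<Rightarrow> complex"
type_synonym 'r operator = "'r label \<Rightarrow> 'r label \<Rightarrow> complex"

definition basis :: "'r set \<Rightarrow> nat \<Rightarrow> 'r label set" where
  "basis S m = S \<times> UNIV \<times> {..<m}"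

definition unitary_on :: "'b set \<Rightarrow> ('b \<Rightarrow> 'b \<Rightarrow> complex) \<Rightarrow> bool" where
  "unitary_on B U \<longleftrightarrow>
     (\<forall>i\<in>B. \<forall>j\<in>B. (\<Sum>k\<in>B. cnj (U k i) * U k j) = (if i = j then 1 else 0) \<and>
                  (\<Sum>k\<in>B. U i k * cnj (U j k)) = (if i = j then 1 else 0))"

definition apply_op :: "'b set \<Rightarrow> ('b \<Rightarrow> 'b \<Rightarrow> complex) \<Rightarrow> ('b \<Rightarrow> complex) \<Rightarrow> 'b \<Rightarrow> complex" where
  "apply_op B U \<psi> = (\<lambda>i. \<Sum>j\<in>B. U i j * \<psi> j)"

text \<open>
  The linear map sending the basis state \<open>(r, b, w)\<close> to \<open>(r, b XOR z r, w)\<close>. This permutation of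
  the basis is an involution, so the same formula describes its effect on coordinates.
\<close>

definition query_gate :: "('r \<Rightarrow> bool) \<Rightarrow> 'r state \<Rightarrow> 'r state" where
  "query_gate z \<psi> = (\<lambda>(r, b, w). \<psi> (r, b \<noteq> z r, w))"

text \<open>
  An algorithm making \<open>calls\<close> queries interleaves them with the gates \<open>gate 0, \<dots>, gate calls\<close>,
  and finally measures in the computational basis, outputting 1 on the outcomes in \<open>accepting\<close>.
  No component of the record depends on the black box.
\<close>

record 'r query_alg =
  workspace :: nat
  start :: "'r label"
  gate :: "nat \<Rightarrow> 'r operator"
  accepting :: "'r label set"
  calls :: nat

definition query_alg :: "'r set \<Rightarrow> 'r query_alg \<Rightarrow> bool" where
  "query_alg S Q \<longleftrightarrow>
     start Q \<in> basis S (workspace Q) \<and>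
     accepting Q \<subseteq> basis S (workspace Q) \<and>
     (\<forall>k\<le>calls Q. unitary_on (basis S (workspace Q)) (gate Q k))"

primrec state_after :: "'r set \<Rightarrow> 'r query_alg \<Rightarrow> ('r \<Rightarrow> bool) \<Rightarrow> nat \<Rightarrow> 'r state" where
  "state_after S Q z 0 =
     apply_op (basis S (workspace Q)) (gate Q 0) (\<lambda>i. if i = start Q then 1 else 0)"
| "state_after S Q z (Suc k) =
     apply_op (basis S (workspace Q)) (gate Q (Suc k)) (query_gate z (state_after S Q z k))"

definition quantum_acceptance :: "'r set \<Rightarrow> 'r query_alg \<Rightarrow> ('r \<Rightarrow> bool) \<Rightarrow> real" where
  "quantum_acceptance S Q z = (\<Sum>i\<in>accepting Q. (cmod (state_after S Q z (calls Q) i))\<^sup>2)"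

text \<open>
  \<open>T\<close> calls suffice if one quantum algorithm with \<open>T\<close> queries works for every classical algorithm
  \<open>A\<close> that one-sidedly computes some \<open>f\<close>. The quantifier over \<open>A\<close> has to be inside: the quantum
  algorithm knows \<open>A\<close> only through the query gate, and for an individual \<open>A\<close> (such as one that
  always rejects) no lower bound on the number of calls could hold.
\<close>

definition calls_suffice :: "nat \<Rightarrow> 'r set \<Rightarrow> real \<Rightarrow> real \<Rightarrow> nat \<Rightarrow> bool" where
  "calls_suffice n S q \<epsilon> T \<longleftrightarrow>
     (\<exists>Q. query_alg S Q \<and> calls Q = T \<and>
       (\<forall>A f. pq_computes 0 q n (classical_acceptance S A) f \<longrightarrow>
              pq_computes 0 (1 - \<epsilon>) n (\<lambda>x. quantum_acceptance S Q (A x)) f))"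

definition amplification_bound :: "real \<Rightarrow> real \<Rightarrow> real \<Rightarrow> real" where
  "amplification_bound N q \<epsilon> = sqrt N * (sqrt (log 2 (1 / \<epsilon>) + q * N) - sqrt (q * N))"

end

theory Submission
  imports Defs "HOL-Complex_Analysis.Complex_Analysis"
begin

text \<open>
  Lower bound: mark every sample independently with probability \<open>x\<close>. The expected rejection
  probability is a polynomial in \<open>x\<close> of degree twice the number of calls. It is 1 at 0, and, by a
  Chernoff bound on the number of marked samples, at most about \<open>\<epsilon>\<close> as soon as \<open>x\<close> exceeds a
  constant times \<open>(log (1/\<epsilon>) + q N) / N\<close>; a polynomial of low degree cannot drop that fast. If
  \<open>log (1/\<epsilon>) + q N < 1\<close>, a hybrid argument for a single marked sample is used instead.

  Upper bound: \<open>m\<close> Grover iterations, with the marked fraction \<open>x\<close> damped to \<open>s x\<close>, leave the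
  start state with amplitude \<open>cos (m \<alpha>)\<close>, where \<open>cos \<alpha> = 1 - 2 s x\<close>. Running several such searches
  in sequence, and setting the successful branches aside after each of them, multiplies these
  amplitudes. With \<open>s = 1/2\<close> and \<open>m\<close> running through the powers of two, one of the factors is at
  most \<open>1/2\<close> in absolute value, which handles all weights \<open>k \<ge> K = max (q N) (log (1/\<epsilon>))\<close> with
  \<open>O(log (1/\<epsilon>) sqrt (N/K))\<close> calls. If \<open>q N < log (1/\<epsilon>)\<close>, one search for each smaller weight \<open>k\<close>,
  with \<open>s\<close> tuned so that the amplitude vanishes exactly, costs \<open>O(sqrt (N/k))\<close> further calls.
\<close>

section \<open>Unitary operators\<close>

lemma apply_op_diff:
  "apply_op B U (\<lambda>i. \<phi> i - \<psi> i) = (\<lambda>i. apply_op B U \<phi> i - apply_op B U \<psi> i)"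
  by (auto simp: apply_op_def sum_subtractf algebra_simps)

lemma apply_op_cong:
  "(\<And>i. i \<in> B \<Longrightarrow> \<phi> i = \<psi> i) \<Longrightarrow> apply_op B U \<phi> = apply_op B U \<psi>"
  by (auto simp: apply_op_def intro!: ext sum.cong)

lemma unitary_on_norm_sum:
  assumes "finite B" and U: "unitary_on B U"
  shows "(\<Sum>i\<in>B. (cmod (apply_op B U \<psi> i))\<^sup>2) = (\<Sum>i\<in>B. (cmod (\<psi> i))\<^sup>2)"
proof -
  have "complex_of_real (\<Sum>i\<in>B. (cmod (apply_op B U \<psi> i))\<^sup>2)
      = (\<Sum>i\<in>B. (\<Sum>k\<in>B. U i k * \<psi> k) * cnj (\<Sum>j\<in>B. U i j * \<psi> j))"
    by (simp only: of_real_sum complex_norm_square apply_op_def)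
  also have "\<dots> = (\<Sum>i\<in>B. \<Sum>j\<in>B. \<Sum>k\<in>B. cnj (\<psi> j) * \<psi> k * (cnj (U i j) * U i k))"
    by (subst mult.commute, simp only: cnj_sum sum_product, simp add: mult_ac)
  also have "\<dots> = (\<Sum>j\<in>B. \<Sum>i\<in>B. \<Sum>k\<in>B. cnj (\<psi> j) * \<psi> k * (cnj (U i j) * U i k))"
    by (rule sum.swap)
  also have "\<dots> = (\<Sum>j\<in>B. \<Sum>k\<in>B. \<Sum>i\<in>B. cnj (\<psi> j) * \<psi> k * (cnj (U i j) * U i k))"
    by (intro sum.cong refl sum.swap)
  also have "\<dots> = (\<Sum>j\<in>B. \<Sum>k\<in>B. cnj (\<psi> j) * \<psi> k * (if j = k then 1 else 0))"
    using U by (intro sum.cong refl) (simp add: unitary_on_def flip: sum_distrib_left)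
  also have "\<dots> = (\<Sum>j\<in>B. cnj (\<psi> j) * \<psi> j)"
    using assms(1) by (simp add: if_distrib[of "\<lambda>x. _ * x"] cong: if_cong)
  also have "\<dots> = complex_of_real (\<Sum>i\<in>B. (cmod (\<psi> i))\<^sup>2)"
    by (simp only: of_real_sum complex_norm_square mult.commute)
  finally show ?thesis using of_real_eq_iff by blast
qed

lemma unitary_on_mult:
  assumes fin: "finite B" and U: "unitary_on B U" and V: "unitary_on B V"
  shows "unitary_on B (\<lambda>i j. \<Sum>k\<in>B. U i k * V k j)"
proof -
  have "(\<Sum>k\<in>B. cnj (\<Sum>l\<in>B. U k l * V l i) * (\<Sum>l\<in>B. U k l * V l j)) = (if i = j then 1 else 0)"
    if ij: "i \<in> B" "j \<in> B" for i j
  proof -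
    have "(\<Sum>k\<in>B. cnj (\<Sum>l\<in>B. U k l * V l i) * (\<Sum>l\<in>B. U k l * V l j))
      = (\<Sum>k\<in>B. \<Sum>l\<in>B. \<Sum>m\<in>B. cnj (V l i) * V m j * (cnj (U k l) * U k m))"
      by (simp only: cnj_sum sum_product, simp add: mult_ac)
    also have "\<dots> = (\<Sum>l\<in>B. \<Sum>k\<in>B. \<Sum>m\<in>B. cnj (V l i) * V m j * (cnj (U k l) * U k m))"
      by (rule sum.swap)
    also have "\<dots> = (\<Sum>l\<in>B. \<Sum>m\<in>B. \<Sum>k\<in>B. cnj (V l i) * V m j * (cnj (U k l) * U k m))"
      by (intro sum.cong refl sum.swap)
    also have "\<dots> = (\<Sum>l\<in>B. \<Sum>m\<in>B. cnj (V l i) * V m j * (if l = m then 1 else 0))"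
      using U by (intro sum.cong refl) (simp add: unitary_on_def flip: sum_distrib_left)
    also have "\<dots> = (\<Sum>l\<in>B. cnj (V l i) * V l j)" using fin by (simp add: if_distrib[of "\<lambda>x. _ * x"] cong: if_cong)
    finally show ?thesis using V ij by (simp add: unitary_on_def)
  qed
  moreover have "(\<Sum>k\<in>B. (\<Sum>l\<in>B. U i l * V l k) * cnj (\<Sum>l\<in>B. U j l * V l k)) = (if i = j then 1 else 0)"
    if ij: "i \<in> B" "j \<in> B" for i j
  proof -
    have "(\<Sum>k\<in>B. (\<Sum>l\<in>B. U i l * V l k) * cnj (\<Sum>l\<in>B. U j l * V l k))
      = (\<Sum>k\<in>B. \<Sum>l\<in>B. \<Sum>m\<in>B. U i l * cnj (U j m) * (V l k * cnj (V m k)))"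
      by (simp only: cnj_sum sum_product, simp add: mult_ac)
    also have "\<dots> = (\<Sum>l\<in>B. \<Sum>k\<in>B. \<Sum>m\<in>B. U i l * cnj (U j m) * (V l k * cnj (V m k)))"
      by (rule sum.swap)
    also have "\<dots> = (\<Sum>l\<in>B. \<Sum>m\<in>B. \<Sum>k\<in>B. U i l * cnj (U j m) * (V l k * cnj (V m k)))"
      by (intro sum.cong refl sum.swap)
    also have "\<dots> = (\<Sum>l\<in>B. \<Sum>m\<in>B. U i l * cnj (U j m) * (if l = m then 1 else 0))"
      using V by (intro sum.cong refl) (simp add: unitary_on_def flip: sum_distrib_left)
    also have "\<dots> = (\<Sum>l\<in>B. U i l * cnj (U j l))" using fin by (simp add: if_distrib[of "\<lambda>x. _ * x"] cong: if_cong)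
    finally show ?thesis using U ij by (simp add: unitary_on_def)
  qed
  ultimately show ?thesis by (simp add: unitary_on_def)
qed

lemma apply_op_mult:
  "apply_op B (\<lambda>i j. \<Sum>k\<in>B. U i k * V k j) \<psi> = apply_op B U (apply_op B V \<psi>)"
proof
  fix i
  have "(\<Sum>j\<in>B. (\<Sum>k\<in>B. U i k * V k j) * \<psi> j) = (\<Sum>j\<in>B. \<Sum>k\<in>B. U i k * (V k j * \<psi> j))"
    by (simp only: sum_distrib_right mult.assoc)
  also have "\<dots> = (\<Sum>k\<in>B. \<Sum>j\<in>B. U i k * (V k j * \<psi> j))" by (rule sum.swap)
  finally show "apply_op B (\<lambda>i j. \<Sum>k\<in>B. U i k * V k j) \<psi> i = apply_op B U (apply_op B V \<psi>) i"
    by (simp add: apply_op_def sum_distrib_left)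
qed

lemma unitary_on_id: "finite B \<Longrightarrow> unitary_on B (\<lambda>i j. if i = j then 1 else 0)"
  by (auto simp: unitary_on_def if_distrib[of cnj] if_distrib[of "\<lambda>x. x * _"] cong: if_cong)

lemma apply_op_id:
  "finite B \<Longrightarrow> i \<in> B \<Longrightarrow> apply_op B (\<lambda>i j. if i = j then 1 else 0) \<psi> i = \<psi> i"
  by (simp add: apply_op_def if_distrib[of "\<lambda>x. x * _"] cong: if_cong)

lemma unitary_on_involution:
  assumes fin: "finite B" and inv: "\<And>i. i \<in> B \<Longrightarrow> \<pi> i \<in> B \<and> \<pi> (\<pi> i) = i"
  shows "unitary_on B (\<lambda>i j. if i = \<pi> j then 1 else 0)"
proof -
  have eq: "k = \<pi> i \<longleftrightarrow> i = \<pi> k" if "i \<in> B" "k \<in> B" for i k using inv that by metis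
  have *: "(\<Sum>k\<in>B. (if i = \<pi> k then 1 else 0) * (if j = \<pi> k then 1 else 0)) = (if i = j then 1 else (0 :: complex))"
    if "i \<in> B" "j \<in> B" for i j
  proof -
    have "(\<Sum>k\<in>B. (if i = \<pi> k then 1 else 0) * (if j = \<pi> k then 1 else 0))
      = (\<Sum>k\<in>B. if k = \<pi> i then (if i = j then 1 else (0 :: complex)) else 0)"
    proof (intro sum.cong refl)
      fix k assume "k \<in> B"
      show "(if i = \<pi> k then 1 else 0) * (if j = \<pi> k then 1 else 0)
        = (if k = \<pi> i then (if i = j then 1 else (0 :: complex)) else 0)"
        unfolding eq[OF that(1) \<open>k \<in> B\<close>] by auto
    qed
    also have "\<dots> = (if i = j then 1 else 0)"
      using inv[OF that(1)] fin by (simp add: sum.delta')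
    finally show ?thesis .
  qed
  moreover have "(\<Sum>k\<in>B. (if k = \<pi> i then 1 else 0) * (if k = \<pi> j then 1 else 0)) = (if i = j then 1 else (0 :: complex))"
    if "i \<in> B" "j \<in> B" for i j
    unfolding *[OF that, symmetric]
  proof (intro sum.cong refl)
    fix k assume "k \<in> B"
    show "(if k = \<pi> i then 1 else 0) * (if k = \<pi> j then 1 else (0 :: complex))
      = (if i = \<pi> k then 1 else 0) * (if j = \<pi> k then 1 else 0)"
      unfolding eq[OF that(1) \<open>k \<in> B\<close>] eq[OF that(2) \<open>k \<in> B\<close>] ..
  qed
  moreover have "cnj (if P then 1 else 0) = (if P then 1 else 0)" for P by simp
  ultimately show ?thesis by (simp only: unitary_on_def) blast
qed

lemma apply_op_involution:
  assumes fin: "finite B" and inv: "\<And>i. i \<in> B \<Longrightarrow> \<pi> i \<in> B \<and> \<pi> (\<pi> i) = i" and i: "i \<in> B"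
  shows "apply_op B (\<lambda>i j. if i = \<pi> j then 1 else 0) \<psi> i = \<psi> (\<pi> i)"
proof -
  have "apply_op B (\<lambda>i j. if i = \<pi> j then 1 else 0) \<psi> i = (\<Sum>j\<in>B. if j = \<pi> i then \<psi> (\<pi> i) else 0)"
    unfolding apply_op_def
  proof (intro sum.cong refl)
    fix j assume "j \<in> B"
    then have "i = \<pi> j \<longleftrightarrow> j = \<pi> i" using inv i by metis
    then show "(if i = \<pi> j then 1 else 0) * \<psi> j = (if j = \<pi> i then \<psi> (\<pi> i) else 0)" by auto
  qed
  then show ?thesis using fin inv[OF i] by simp
qed

text \<open>The matrix 2 v v^T - 1, for a real unit vector the reflection through its line. It
  occurs both as the diffusion operator of Grover's search and, for the bisector of two unit
  vectors, as the gate exchanging them.\<close>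

definition reflection :: "('b \<Rightarrow> real) \<Rightarrow> 'b \<Rightarrow> 'b \<Rightarrow> complex" where
  "reflection v i j = of_real (2 * v i * v j) - (if i = j then 1 else 0)"

lemma apply_op_reflection:
  assumes "finite B" "i \<in> B"
  shows "apply_op B (reflection v) \<psi> i = 2 * of_real (v i) * (\<Sum>j\<in>B. of_real (v j) * \<psi> j) - \<psi> i"
  using assms
  by (simp add: apply_op_def reflection_def algebra_simps sum_subtractf sum_distrib_left
      if_distrib[of "\<lambda>x. x * _"] if_distrib[of "\<lambda>x. _ * x"] cong: if_cong)

text \<open>A real symmetric matrix is unitary as soon as its square is the identity; the latter
  holds because the reflection fixes \<open>v\<close>.\<close>

lemma unitary_on_reflection:
  assumes fin: "finite B" and v: "(\<Sum>i\<in>B. (v i)\<^sup>2) = 1"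
  shows "unitary_on B (reflection v)"
proof -
  have sym: "reflection v i j = reflection v j i" "cnj (reflection v i j) = reflection v i j" for i j
    by (auto simp: reflection_def)
  have sq: "(\<Sum>k\<in>B. reflection v i k * reflection v k j) = (if i = j then 1 else 0)"
    if ij: "i \<in> B" "j \<in> B" for i j
  proof -
    have *: "(\<Sum>k\<in>B. complex_of_real (v k) * reflection v k j) = of_real (v j)"
    proof -
      have "(\<Sum>k\<in>B. complex_of_real (v k) * reflection v k j)
        = (\<Sum>k\<in>B. of_real (2 * v j) * of_real ((v k)\<^sup>2)) - of_real (v j)"
        using fin ij
        by (simp add: reflection_def algebra_simps sum_subtractf power2_eq_square
           if_distrib[of "\<lambda>x. _ * x"] cong: if_cong)
      also have "\<dots> = of_real (2 * v j) * of_real (\<Sum>k\<in>B. (v k)\<^sup>2) - of_real (v j)"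
        by (simp add: sum_distrib_left)
      finally show ?thesis using v by simp
    qed
    have "(\<Sum>k\<in>B. reflection v i k * reflection v k j) = apply_op B (reflection v) (\<lambda>k. reflection v k j) i"
      by (simp add: apply_op_def)
    also have "\<dots> = 2 * of_real (v i) * of_real (v j) - reflection v i j"
      using apply_op_reflection[OF fin ij(1), of v "\<lambda>k. reflection v k j"] * by simp
    finally show ?thesis by (simp add: reflection_def)
  qed
  show ?thesis
    unfolding unitary_on_def
  proof (intro ballI conjI)
    fix i j assume ij: "i \<in> B" "j \<in> B"
    show "(\<Sum>k\<in>B. cnj (reflection v k i) * reflection v k j) = (if i = j then 1 else 0)"
      using sq[OF ij] by (simp only: sym(2) sym(1)[of _ i])
    show "(\<Sum>k\<in>B. reflection v i k * cnj (reflection v j k)) = (if i = j then 1 else 0)"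
      using sq[OF ij] by (simp only: sym(2) sym(1)[of j])
  qed
qed

section \<open>Preparable states\<close>

lemma xor_xor [simp]: "((b = (\<not> c)) = (\<not> c)) = b"
  by auto

lemma finite_basis: "finite S \<Longrightarrow> finite (basis S m)"
  by (simp add: basis_def)

lemma sum_basis_query_gate:
  "(\<Sum>i\<in>basis S m. f (query_gate z \<psi> i)) = (\<Sum>i\<in>basis S m. f (\<psi> i))"
  by (rule sum.reindex_bij_witness[of _ "\<lambda>(r, b, w). (r, b \<noteq> z r, w)" "\<lambda>(r, b, w). (r, b \<noteq> z r, w)"])
     (auto simp: basis_def query_gate_def)

lemma state_after_norm:
  assumes "finite S" "query_alg S Q" "k \<le> calls Q"
  shows "(\<Sum>i\<in>basis S (workspace Q). (cmod (state_after S Q z k i))\<^sup>2) = 1"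
  using assms(3)
proof (induction k)
  case 0
  have "start Q \<in> basis S (workspace Q)" using assms by (simp add: query_alg_def)
  then show ?case
    using assms 
    by (simp add: query_alg_def unitary_on_norm_sum finite_basis if_distrib[of cmod]
       if_distrib[of "\<lambda>x. x\<^sup>2"] cong: if_cong)
next
  case (Suc k)
  then show ?case
    using assms sum_basis_query_gate[of "\<lambda>x. (cmod x)\<^sup>2" z "state_after S Q z k"]
    by (simp add: query_alg_def unitary_on_norm_sum finite_basis)
qed

text \<open>Families of states, indexed by the black box, that arise from a start state with
  \<open>T\<close> queries. Any number of gates may stand between two queries, which makes composing
  algorithms easy.\<close>

inductive preparable :: "'r set \<Rightarrow> nat \<Rightarrow> 'r label \<Rightarrow> nat \<Rightarrow> (('r \<Rightarrow> bool) \<Rightarrow> 'r state) \<Rightarrow> bool"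
  for S m st where
  start: "preparable S m st 0 (\<lambda>z i. if i = st then 1 else 0)"
| gate: "preparable S m st T \<Psi> \<Longrightarrow> unitary_on (basis S m) U \<Longrightarrow>
    preparable S m st T (\<lambda>z. apply_op (basis S m) U (\<Psi> z))"
| query: "preparable S m st T \<Psi> \<Longrightarrow> preparable S m st (Suc T) (\<lambda>z. query_gate z (\<Psi> z))"

lemma state_after_cong:
  assumes "workspace Q = workspace Q'" "start Q = start Q'" "\<And>k. k \<le> T \<Longrightarrow> gate Q k = gate Q' k"
  shows "state_after S Q z T = state_after S Q' z T"
  using assms(3) by (induction T) (simp_all add: assms(1,2))

text \<open>A gate is absorbed into the last gate of the sequence by matrix multiplication; a query
  is followed by an identity gate. The accepting set and \<open>calls\<close> stay arbitrary, since
  the state after \<open>T\<close> queries does not depend on them.\<close>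

lemma preparable_imp_query_alg:
  assumes "finite S" "preparable S m st T \<Psi>"
  shows "\<exists>G. (\<forall>k. unitary_on (basis S m) (G k)) \<and>
    (\<forall>acc c z. \<forall>i\<in>basis S m. state_after S
      \<lparr>workspace = m, start = st, gate = G, accepting = acc, calls = c\<rparr> z T i = \<Psi> z i)"
  using assms(2)
proof induction
  case start
  have "unitary_on (basis S m) (\<lambda>i j. if i = j then 1 else 0)"
    using unitary_on_id[OF finite_basis[OF assms(1)]] .
  then show ?case
    by (intro exI[of _ "\<lambda>_ i j. if i = j then 1 else 0"]) (simp add: apply_op_id finite_basis assms(1))
next
  case (gate T \<Psi> U)
  then obtain G where G: "\<And>k. unitary_on (basis S m) (G k)"
    "\<And>acc c z i. i \<in> basis S m \<Longrightarrow> state_after S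
      \<lparr>workspace = m, start = st, gate = G, accepting = acc, calls = c\<rparr> z T i = \<Psi> z i" by blast
  let ?V = "\<lambda>i j. \<Sum>k\<in>basis S m. U i k * G T k j"
  let ?Q = "\<lambda>G acc c. \<lparr>workspace = m, start = st, gate = G, accepting = acc, calls = c\<rparr>"
  have eq: "state_after S (?Q (G(T := ?V)) acc c) z T
      = apply_op (basis S m) U (state_after S (?Q G acc c) z T)" for acc c z
  proof (cases T)
    case 0
    then show ?thesis by (simp add: apply_op_mult)
  next
    case (Suc k)
    have "state_after S (?Q (G(T := ?V)) acc c) z k = state_after S (?Q G acc c) z k"
      using Suc by (intro state_after_cong) auto
    then show ?thesis by (simp add: Suc apply_op_mult)
  qed
  show ?case
  proof (intro exI[of _ "G(T := ?V)"] conjI allI ballI)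
    fix k show "unitary_on (basis S m) ((G(T := ?V)) k)"
      using G(1) unitary_on_mult[OF finite_basis[OF assms(1)] gate(2) G(1)] by simp
  next
    fix acc c z i
    show "state_after S (?Q (G(T := ?V)) acc c) z T i = apply_op (basis S m) U (\<Psi> z) i"
      unfolding eq using G(2) by (metis apply_op_cong)
  qed
next
  case (query T \<Psi>)
  then obtain G where G: "\<And>k. unitary_on (basis S m) (G k)"
    "\<And>acc c z i. i \<in> basis S m \<Longrightarrow> state_after S
      \<lparr>workspace = m, start = st, gate = G, accepting = acc, calls = c\<rparr> z T i = \<Psi> z i" by blast
  let ?V = "\<lambda>i j. if i = j then 1 else 0"
  let ?Q = "\<lambda>G acc c. \<lparr>workspace = m, start = st, gate = G, accepting = acc, calls = c\<rparr>"
  have eq: "state_after S (?Q (G(Suc T := ?V)) acc c) z T = state_after S (?Q G acc c) z T" for acc c z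
    by (intro state_after_cong) auto
  show ?case
  proof (intro exI[of _ "G(Suc T := ?V)"] conjI allI ballI)
    fix k show "unitary_on (basis S m) ((G(Suc T := ?V)) k)"
      using G(1) unitary_on_id[OF finite_basis[OF assms(1)]] by simp
  next
    fix acc c z i assume i: "i \<in> basis S m"
    have "state_after S (?Q (G(Suc T := ?V)) acc c) z (Suc T) i
        = query_gate z (state_after S (?Q G acc c) z T) i"
      using i eq by (simp add: apply_op_id finite_basis assms(1))
    also have "\<dots> = query_gate z (\<Psi> z) i"
      using i G(2) by (auto simp: query_gate_def basis_def)
    finally show "state_after S (?Q (G(Suc T := ?V)) acc c) z (Suc T) i = query_gate z (\<Psi> z) i" .
  qed
qed

definition lift :: "('r \<times> bool \<Rightarrow> 'r \<times> bool \<Rightarrow> complex) \<Rightarrow> 'r operator" where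
  "lift U = (\<lambda>(r, b, w) (r', b', w'). if w = w' then U (r, b) (r', b') else 0)"

definition slice :: "'r state \<Rightarrow> nat \<Rightarrow> 'r \<times> bool \<Rightarrow> complex" where
  "slice \<psi> w = (\<lambda>(r, b). \<psi> (r, b, w))"

definition slice_query :: "('r \<Rightarrow> bool) \<Rightarrow> ('r \<times> bool \<Rightarrow> complex) \<Rightarrow> 'r \<times> bool \<Rightarrow> complex" where
  "slice_query z \<phi> = (\<lambda>(r, b). \<phi> (r, b \<noteq> z r))"

lemma slice_query_gate: "slice (query_gate z \<psi>) w = slice_query z (slice \<psi> w)"
  by (auto simp: slice_def query_gate_def slice_query_def)

lemma sum_basis_slices:
  "(\<Sum>i\<in>basis S m. f i) = (\<Sum>w<m. \<Sum>p\<in>S \<times> UNIV. f (fst p, snd p, w))"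
proof -
  have "(\<Sum>i\<in>basis S m. f i) = (\<Sum>(w, p)\<in>{..<m} \<times> (S \<times> UNIV). f (fst p, snd p, w))"
    by (rule sum.reindex_bij_witness[of _ "\<lambda>(w, p). (fst p, snd p, w)" "\<lambda>(r, b, w). (w, r, b)"])
       (auto simp: basis_def)
  then show ?thesis by (simp add: sum.cartesian_product)
qed

lemma slice_apply_lift:
  assumes "w < m"
  shows "slice (apply_op (basis S m) (lift U) \<psi>) w = apply_op (S \<times> UNIV) U (slice \<psi> w)"
proof
  fix p :: "'a \<times> bool"
  obtain r b where p: "p = (r, b)" by fastforce
  have "slice (apply_op (basis S m) (lift U) \<psi>) w p
    = (\<Sum>w'<m. \<Sum>p'\<in>S \<times> UNIV. lift U (r, b, w) (fst p', snd p', w') * \<psi> (fst p', snd p', w'))"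
    by (simp add: slice_def apply_op_def sum_basis_slices p)
  also have "\<dots> = (\<Sum>w'<m. if w' = w then apply_op (S \<times> UNIV) U (slice \<psi> w) p else 0)"
    by (intro sum.cong refl) (auto simp: lift_def apply_op_def slice_def p split_def)
  also have "\<dots> = apply_op (S \<times> UNIV) U (slice \<psi> w) p" using assms by simp
  finally show "slice (apply_op (basis S m) (lift U) \<psi>) w p = apply_op (S \<times> UNIV) U (slice \<psi> w) p" .
qed

lemma unitary_on_lift:
  assumes U: "unitary_on (S \<times> UNIV) U"
  shows "unitary_on (basis S m) (lift U)"
  unfolding unitary_on_def
proof (intro ballI conjI)
  fix i j assume "i \<in> basis S m" "j \<in> basis S m"
  then obtain r b w r' b' w' where ij: "i = (r, b, w)" "j = (r', b', w')"
    "w < m" "w' < m" "(r, b) \<in> S \<times> UNIV" "(r', b') \<in> S \<times> UNIV"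
    by (auto simp: basis_def)
  have "(\<Sum>k\<in>basis S m. cnj (lift U k i) * lift U k j)
    = (\<Sum>v<m. if v = w then (if w = w' then \<Sum>p\<in>S \<times> UNIV. cnj (U p (r, b)) * U p (r', b') else 0) else 0)"
    unfolding sum_basis_slices by (intro sum.cong refl) (auto simp: lift_def ij)
  also have "\<dots> = (if i = j then 1 else 0)"
    using U ij by (auto simp: unitary_on_def)
  finally show "(\<Sum>k\<in>basis S m. cnj (lift U k i) * lift U k j) = (if i = j then 1 else 0)" .
  have "(\<Sum>k\<in>basis S m. lift U i k * cnj (lift U j k))
    = (\<Sum>v<m. if v = w then (if w = w' then \<Sum>p\<in>S \<times> UNIV. U (r, b) p * cnj (U (r', b') p) else 0) else 0)"
    unfolding sum_basis_slices by (intro sum.cong refl) (auto simp: lift_def ij)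
  also have "\<dots> = (if i = j then 1 else 0)"
    using U ij by (auto simp: unitary_on_def)
  finally show "(\<Sum>k\<in>basis S m. lift U i k * cnj (lift U j k)) = (if i = j then 1 else 0)" .
qed

text \<open>One Grover iteration. The answer bit is part of the vector \<open>v\<close>, so the
  reflection acts on query register and answer bit jointly, and the query itself takes the place of
  the sign flip on marked elements.\<close>

definition grover_step :: "'r set \<Rightarrow> ('r \<times> bool \<Rightarrow> real) \<Rightarrow> ('r \<Rightarrow> bool) \<Rightarrow>
    ('r \<times> bool \<Rightarrow> complex) \<Rightarrow> 'r \<times> bool \<Rightarrow> complex" where
  "grover_step S v z \<phi> = apply_op (S \<times> UNIV) (reflection v) (slice_query z \<phi>)"

text \<open>
  The span of \<open>v\<close> and its image under the query is invariant; the second identity carries the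
  Chebyshev recurrence \<open>cos ((k + 2) \<alpha>) = 2 cos \<alpha> cos ((k + 1) \<alpha>) - cos (k \<alpha>)\<close>.
\<close>

lemma grover_iterates:
  fixes v :: "'r \<times> bool \<Rightarrow> real" and g :: complex
  defines "V \<equiv> (\<lambda>p. of_real (v p))"
  assumes fin: "finite S" and v: "(\<Sum>p\<in>S \<times> UNIV. (v p)\<^sup>2) = 1"
    and c: "(\<Sum>p\<in>S \<times> UNIV. V p * slice_query z V p) = of_real (cos \<alpha>)"
    and \<phi>: "\<And>p. p \<in> S \<times> UNIV \<Longrightarrow> \<phi> p = g * V p"
  shows "\<exists>a b. (\<forall>p\<in>S \<times> UNIV. (grover_step S v z ^^ k) \<phi> p
        = g * (of_real a * V p + of_real b * slice_query z V p)) \<and>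
      a + cos \<alpha> * b = cos (of_nat k * \<alpha>) \<and> cos \<alpha> * a + b = cos (of_nat (Suc k) * \<alpha>)"
proof (induction k)
  case 0
  then show ?case using \<phi> by (intro exI[of _ 1] exI[of _ 0]) auto
next
  case (Suc k)
  then obtain a b where ab: "\<And>p. p \<in> S \<times> UNIV \<Longrightarrow> (grover_step S v z ^^ k) \<phi> p
        = g * (of_real a * V p + of_real b * slice_query z V p)"
    "a + cos \<alpha> * b = cos (of_nat k * \<alpha>)" "cos \<alpha> * a + b = cos (of_nat (Suc k) * \<alpha>)" by blast
  let ?O = "slice_query z V"
  have vv: "(\<Sum>p\<in>S \<times> UNIV. V p * V p) = 1"
    using arg_cong[OF v, of complex_of_real] by (simp add: V_def power2_eq_square)
  \<comment> \<open>Querying twice is the identity, so a query exchanges \<open>V\<close> and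
    \<open>?O\<close>.\<close>
  have q: "slice_query z ((grover_step S v z ^^ k) \<phi>) p = g * (of_real a * ?O p + of_real b * V p)"
    if "p \<in> S \<times> UNIV" for p
    using ab(1)[of "(fst p, snd p \<noteq> z (fst p))"] that
    by (auto simp: slice_query_def split: prod.splits)
  have ip: "(\<Sum>p\<in>S \<times> UNIV. V p * slice_query z ((grover_step S v z ^^ k) \<phi>) p)
      = g * of_real (cos \<alpha> * a + b)"
  proof -
    have "(\<Sum>p\<in>S \<times> UNIV. V p * slice_query z ((grover_step S v z ^^ k) \<phi>) p)
      = (\<Sum>p\<in>S \<times> UNIV. g * of_real a * (V p * ?O p) + g * of_real b * (V p * V p))"
      by (intro sum.cong refl) (simp add: q algebra_simps)
    also have "\<dots> = g * of_real a * of_real (cos \<alpha>) + g * of_real b"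
      by (simp only: sum.distrib flip: sum_distrib_left) (simp only: c vv mult_1_right)
    finally show ?thesis by (simp add: algebra_simps)
  qed
  \<comment> \<open>After the exchange, reflecting at \<open>V\<close> takes the coefficients
    \<open>(a, b)\<close> of \<open>V\<close> and \<open>?O\<close> to
    \<open>(2 * cos \<alpha> * a + b, - a)\<close>.\<close>
  have "(grover_step S v z ^^ Suc k) \<phi> p
      = g * (of_real (2 * cos \<alpha> * a + b) * V p + of_real (- a) * ?O p)" if p: "p \<in> S \<times> UNIV" for p
  proof -
    have "(grover_step S v z ^^ Suc k) \<phi> p = 2 * V p * (g * of_real (cos \<alpha> * a + b))
        - g * (of_real a * ?O p + of_real b * V p)"
      using apply_op_reflection[of "S \<times> UNIV" p v "slice_query z ((grover_step S v z ^^ k) \<phi>)"]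
        fin p ip q[OF p] by (simp add: grover_step_def V_def)
    then show ?thesis by (simp add: algebra_simps)
  qed
  moreover have "2 * cos \<alpha> * a + b + cos \<alpha> * (- a) = cos (of_nat (Suc k) * \<alpha>)"
    unfolding ab(3)[symmetric] by (simp add: algebra_simps)
  moreover have "cos \<alpha> * (2 * cos \<alpha> * a + b) + (- a) = cos (of_nat (Suc (Suc k)) * \<alpha>)"
  proof -
    have "cos (of_nat (Suc (Suc k)) * \<alpha>) + cos (of_nat k * \<alpha>) = 2 * cos \<alpha> * cos (of_nat (Suc k) * \<alpha>)"
      using cos_plus_cos[of "of_nat (Suc (Suc k)) * \<alpha>" "of_nat k * \<alpha>"] by (simp add: algebra_simps add_divide_distrib)
    then show ?thesis unfolding ab(2,3)[symmetric] by (simp add: algebra_simps)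
  qed
  ultimately show ?case by blast
qed

section \<open>Amplitude of a sequence of searches\<close>

text \<open>
  The answer bit is in the state \<open>sqrt (1 - s) |+> + sqrt s |->\<close>: a query flips the sign of the
  second summand only, so it acts as if the marked fraction were scaled by \<open>s\<close>.
\<close>

definition search_state :: "'r set \<Rightarrow> real \<Rightarrow> 'r \<times> bool \<Rightarrow> real" where
  "search_state S s = (\<lambda>(r, b). (if b then sqrt (1 - s) - sqrt s else sqrt (1 - s) + sqrt s)
     / sqrt (2 * real (card S)))"

text \<open>The cosine of the rotation angle \<alpha> of one iteration: the marked fraction, damped
  by \<open>s\<close>, is sin^2(\<alpha>/2).\<close>

definition marked_cos :: "'r set \<Rightarrow> ('r \<Rightarrow> bool) \<Rightarrow> real \<Rightarrow> real" where
  "marked_cos S z s = 1 - 2 * s * real (card {r \<in> S. z r}) / real (card S)"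

lemma sum_times_bool: "(\<Sum>p\<in>S \<times> UNIV. f p) = (\<Sum>r\<in>S. f (r, True) + f (r, False))"
proof -
  have "(\<Sum>p\<in>S \<times> UNIV. f p) = (\<Sum>r\<in>S. \<Sum>b\<in>UNIV. f (r, b))"
    by (simp add: sum.cartesian_product)
  then show ?thesis by (simp add: UNIV_bool add.commute)
qed

lemma search_state_norm:
  assumes "finite S" "S \<noteq> {}" "0 \<le> s" "s \<le> 1"
  shows "(\<Sum>p\<in>S \<times> UNIV. (search_state S s p)\<^sup>2) = 1"
proof -
  have "(search_state S s (r, True))\<^sup>2 + (search_state S s (r, False))\<^sup>2 = 1 / real (card S)" for r
  proof -
    have "(sqrt (1 - s) - sqrt s)\<^sup>2 + (sqrt (1 - s) + sqrt s)\<^sup>2 = 2"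
      using assms by (simp add: power2_sum power2_diff)
    then show ?thesis using assms
      by (simp add: search_state_def power_divide flip: add_divide_distrib)
  qed
  then show ?thesis using assms by (simp add: sum_times_bool)
qed

text \<open>An unmarked sample contributes its weight 1/N, with N the number of samples; for a
  marked one the two answer amplitudes are multiplied crosswise, which leaves (1 - 2s)/N. The total
  is the cosine that \<open>grover_iterates\<close> asks for.\<close>

lemma search_state_query:
  assumes "finite S" "S \<noteq> {}" "0 \<le> s" "s \<le> 1"
  defines "V \<equiv> (\<lambda>p. complex_of_real (search_state S s p))"
  shows "(\<Sum>p\<in>S \<times> UNIV. V p * slice_query z V p) = of_real (marked_cos S z s)"
proof -
  have n: "real (card S) > 0" using assms by (simp add: card_gt_0_iff)
  have sq: "(sqrt (1 - s) - sqrt s)\<^sup>2 + (sqrt (1 - s) + sqrt s)\<^sup>2 = 2"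
    "(sqrt (1 - s) - sqrt s) * (sqrt (1 - s) + sqrt s) = 1 - 2 * s"
    using assms by (simp_all add: power2_sum power2_diff algebra_simps)
  have "V (r, True) * slice_query z V (r, True) + V (r, False) * slice_query z V (r, False)
    = of_real (1 / real (card S) - (if z r then 2 * s / real (card S) else 0))" for r
  proof (cases "z r")
    case True
    have "V (r, True) * slice_query z V (r, True) + V (r, False) * slice_query z V (r, False)
      = of_real (2 * (search_state S s (r, True) * search_state S s (r, False)))"
      using True by (simp add: slice_query_def V_def)
    also have "search_state S s (r, True) * search_state S s (r, False)
      = ((sqrt (1 - s) - sqrt s) * (sqrt (1 - s) + sqrt s)) / (2 * real (card S))"
      using n by (simp add: search_state_def)
    also have "2 * (((sqrt (1 - s) - sqrt s) * (sqrt (1 - s) + sqrt s)) / (2 * real (card S)))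
      = 1 / real (card S) - 2 * s / real (card S)"
      unfolding sq using n by (simp add: field_simps)
    finally show ?thesis using True by simp
  next
    case False
    have "V (r, True) * slice_query z V (r, True) + V (r, False) * slice_query z V (r, False)
      = of_real ((search_state S s (r, True))\<^sup>2 + (search_state S s (r, False))\<^sup>2)"
      using False by (simp add: slice_query_def V_def power2_eq_square)
    also have "(search_state S s (r, True))\<^sup>2 + (search_state S s (r, False))\<^sup>2
      = ((sqrt (1 - s) - sqrt s)\<^sup>2 + (sqrt (1 - s) + sqrt s)\<^sup>2) / (2 * real (card S))"
      using n by (simp add: search_state_def power_divide flip: add_divide_distrib)
    finally show ?thesis using False n unfolding sq by simp
  qed
  then have "(\<Sum>p\<in>S \<times> UNIV. V p * slice_query z V p)
    = of_real (\<Sum>r\<in>S. 1 / real (card S) - (if z r then 2 * s / real (card S) else 0))"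
    by (simp add: sum_times_bool)
  also have "(\<Sum>r\<in>S. 1 / real (card S) - (if z r then 2 * s / real (card S) else 0))
     = marked_cos S z s"
    using assms(1,2) n by (simp add: sum_subtractf marked_cos_def sum.inter_filter[symmetric])
  finally show ?thesis .
qed

lemma marked_cos_bounds:
  assumes "finite S" "S \<noteq> {}" "0 \<le> s" "s \<le> 1"
  shows "-1 \<le> marked_cos S z s" "marked_cos S z s \<le> 1"
proof -
  have n: "real (card S) > 0" using assms by (simp add: card_gt_0_iff)
  have "card {r \<in> S. z r} \<le> card S" using assms(1) by (intro card_mono) auto
  then have "s * real (card {r \<in> S. z r}) \<le> 1 * real (card S)"
    using assms by (intro mult_mono) auto
  then show "-1 \<le> marked_cos S z s" "marked_cos S z s \<le> 1"
    using n assms by (auto simp: marked_cos_def field_simps)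
qed

text \<open>
  Slice 0 of the workspace carries the not yet successful branch, which is always a multiple of
  the basis state \<open>(r0, False)\<close>; the slices above \<open>j\<close> are still unused.
\<close>

definition unsuccessful :: "'r set \<Rightarrow> nat \<Rightarrow> 'r \<Rightarrow> nat \<Rightarrow> (('r \<Rightarrow> bool) \<Rightarrow> real) \<Rightarrow>
    (('r \<Rightarrow> bool) \<Rightarrow> 'r state) \<Rightarrow> bool" where
  "unsuccessful S m r0 j g \<Psi> \<longleftrightarrow>
     (\<forall>z. \<forall>p\<in>S \<times> UNIV. slice (\<Psi> z) 0 p = of_real (g z) * (if p = (r0, False) then 1 else 0)) \<and>
     (\<forall>z w. j < w \<and> w < m \<longrightarrow> (\<forall>p\<in>S \<times> UNIV. slice (\<Psi> z) w p = 0))"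

text \<open>All slices evolve in parallel under the same queries, so \<open>k\<close> iterations
  cost \<open>k\<close> calls whatever the number of slices.\<close>

lemma preparable_grover_steps:
  assumes "preparable S m st T \<Psi>" "unitary_on (S \<times> UNIV) (reflection v)"
  shows "\<exists>\<Psi>'. preparable S m st (T + k) \<Psi>' \<and>
    (\<forall>z. \<forall>w<m. slice (\<Psi>' z) w = (grover_step S v z ^^ k) (slice (\<Psi> z) w))"
proof (induction k)
  case 0
  then show ?case using assms by auto
next
  case (Suc k)
  then obtain \<Psi>' where \<Psi>': "preparable S m st (T + k) \<Psi>'"
    "\<And>z w. w < m \<Longrightarrow> slice (\<Psi>' z) w = (grover_step S v z ^^ k) (slice (\<Psi> z) w)" by blast
  show ?case
    by (intro exI[of _ "\<lambda>z. apply_op (basis S m) (lift (reflection v)) (query_gate z (\<Psi>' z))"] conjI)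
       (use preparable.gate[OF preparable.query[OF \<Psi>'(1)] unitary_on_lift[OF assms(2)]] in
         \<open>auto simp: slice_apply_lift slice_query_gate \<Psi>'(2) simp flip: grover_step_def\<close>)
qed

lemma grover_step_zero:
  assumes "\<And>p. p \<in> S \<times> UNIV \<Longrightarrow> \<phi> p = 0" "finite S" "p \<in> S \<times> UNIV"
  shows "(grover_step S v z ^^ k) \<phi> p = 0"
  using assms(3)
proof (induction k arbitrary: p)
  case (Suc k)
  have "slice_query z ((grover_step S v z ^^ k) \<phi>) p = 0" if "p \<in> S \<times> UNIV" for p
    using Suc.IH that by (auto simp: slice_query_def)
  moreover have "(grover_step S v z ^^ Suc k) \<phi> p
      = apply_op (S \<times> UNIV) (reflection v) (slice_query z ((grover_step S v z ^^ k) \<phi>)) p"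
    by (simp add: grover_step_def[of S v z "(grover_step S v z ^^ k) \<phi>"])
  ultimately show ?case using Suc.prems assms(2)
    by (simp add: apply_op_reflection)
qed (use assms in auto)

text \<open>A reflection turns the idle state \<open>e\<close> into the search state,
  \<open>k\<close> iterations follow, and the same reflection turns back. The amplitude left on
  \<open>e\<close> is the overlap with the search state, that is, cos(k \<alpha>) times the old
  amplitude. Everything else in slice 0 is then moved into the fresh slice \<open>Suc j\<close>, so
  that later searches cannot bring it back.\<close>

lemma preparable_search:
  assumes fin: "finite S" and r0: "r0 \<in> S" and s: "0 \<le> s" "s \<le> 1"
    and prep: "preparable S m st T \<Psi>" and inv: "unsuccessful S m r0 j g \<Psi>" and j: "Suc j < m"
  shows "\<exists>\<Psi>'. preparable S m st (T + k) \<Psi>' \<and>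
    unsuccessful S m r0 (Suc j) (\<lambda>z. g z * cos (of_nat k * arccos (marked_cos S z s))) \<Psi>'"
proof -
  let ?P = "S \<times> (UNIV :: bool set)"
  have ne: "S \<noteq> {}" and finP: "finite ?P" using fin r0 by auto
  define e where "e = (r0, False)"
  have e: "e \<in> ?P" using r0 by (simp add: e_def)
  define v where "v = search_state S s"
  note vn = search_state_norm[OF fin ne s, folded v_def]
  have ve: "0 \<le> v e" using s by (simp add: v_def search_state_def e_def)
  \<comment> \<open>The normalised bisector of \<open>v\<close> and the basis vector at
    \<open>e\<close>: its reflection exchanges the two. That \<open>v e\<close> is nonnegative keeps
    the normalising factor positive.\<close>
  define u where "u p = ((if p = e then 1 else 0) + v p) / sqrt (2 + 2 * v e)" for p
  have un: "(\<Sum>p\<in>?P. (u p)\<^sup>2) = 1"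
  proof -
    have "(\<Sum>p\<in>?P. ((if p = e then 1 else 0) + v p)\<^sup>2)
      = (\<Sum>p\<in>?P. (if p = e then 1 + 2 * v e else 0) + (v p)\<^sup>2)"
      by (intro sum.cong refl) (auto simp: power2_sum)
    also have "\<dots> = 2 + 2 * v e" using vn e finP by (simp add: sum.distrib)
    finally show ?thesis using ve by (simp add: u_def power_divide flip: sum_divide_distrib)
  qed
  have ue: "u p * u e = ((if p = e then 1 else 0) + v p) / 2" for p
  proof -
    have "u p * u e = ((if p = e then 1 else 0) + v p) * (1 + v e) / (2 + 2 * v e)"
      using ve by (simp add: u_def)
    also have "2 + 2 * v e = 2 * (1 + v e)" by simp
    also have "((if p = e then 1 else 0) + v p) * (1 + v e) / (2 * (1 + v e))
      = ((if p = e then 1 else 0) + v p) / 2"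
      using ve by (intro nonzero_mult_divide_mult_cancel_right) simp
    finally show ?thesis .
  qed
  have Uu: "unitary_on ?P (reflection u)" "unitary_on ?P (reflection v)"
    using un vn finP by (auto intro: unitary_on_reflection)
  define \<Psi>1 where "\<Psi>1 z = apply_op (basis S m) (lift (reflection u)) (\<Psi> z)" for z
  have prep1: "preparable S m st T \<Psi>1"
    unfolding \<Psi>1_def by (intro preparable.gate prep unitary_on_lift Uu)
  have inv0: "\<And>z p. p \<in> ?P \<Longrightarrow> slice (\<Psi> z) 0 p = of_real (g z) * (if p = e then 1 else 0)"
    and invw: "\<And>z w p. j < w \<Longrightarrow> w < m \<Longrightarrow> p \<in> ?P \<Longrightarrow> slice (\<Psi> z) w p = 0"
    using inv unfolding unsuccessful_def e_def by blast+
  have \<Psi>1_0: "slice (\<Psi>1 z) 0 p = of_real (g z) * of_real (v p)" if p: "p \<in> ?P" for z p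
  proof -
    have "(\<Sum>p\<in>?P. of_real (u p) * slice (\<Psi> z) 0 p) = of_real (g z) * complex_of_real (u e)"
    proof -
      have "(\<Sum>p\<in>?P. of_real (u p) * slice (\<Psi> z) 0 p)
        = (\<Sum>p\<in>?P. if p = e then of_real (g z) * complex_of_real (u e) else 0)"
        by (intro sum.cong refl) (simp add: inv0)
      then show ?thesis using e finP by simp
    qed
    then have "slice (\<Psi>1 z) 0 p
      = of_real (g z) * of_real (2 * (u p * u e) - (if p = e then 1 else 0))"
      using j p by (simp add: \<Psi>1_def slice_apply_lift apply_op_reflection[OF finP p] inv0 algebra_simps)
    also have "2 * (u p * u e) - (if p = e then 1 else 0) = v p"
      unfolding ue by (simp add: field_simps)
    finally show ?thesis .
  qed
  have \<Psi>1_w: "slice (\<Psi>1 z) w p = 0" if "p \<in> ?P" "j < w" "w < m" for z w p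
    using that invw by (simp add: \<Psi>1_def slice_apply_lift apply_op_reflection[OF finP that(1)])
  obtain \<Psi>2 where prep2: "preparable S m st (T + k) \<Psi>2"
    and \<Psi>2: "\<And>z w. w < m \<Longrightarrow> slice (\<Psi>2 z) w = (grover_step S v z ^^ k) (slice (\<Psi>1 z) w)"
    using preparable_grover_steps[OF prep1 Uu(2), of k] by blast
  have \<Psi>2_w: "slice (\<Psi>2 z) w p = 0" if "p \<in> ?P" "j < w" "w < m" for z w p
    using that \<Psi>1_w grover_step_zero[OF _ fin] by (simp add: \<Psi>2)
  define \<Psi>3 where "\<Psi>3 z = apply_op (basis S m) (lift (reflection u)) (\<Psi>2 z)" for z
  have prep3: "preparable S m st (T + k) \<Psi>3"
    unfolding \<Psi>3_def by (intro preparable.gate prep2 unitary_on_lift Uu)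
  have \<Psi>3_w: "slice (\<Psi>3 z) w p = 0" if "p \<in> ?P" "j < w" "w < m" for z w p
    using that \<Psi>2_w by (simp add: \<Psi>3_def slice_apply_lift apply_op_reflection[OF finP that(1)])
  have \<Psi>3_e: "slice (\<Psi>3 z) 0 e = of_real (g z * cos (of_nat k * arccos (marked_cos S z s)))" for z
  proof -
    let ?c = "marked_cos S z s" and ?V = "\<lambda>p. complex_of_real (v p)"
    have cos: "cos (arccos ?c) = ?c" using marked_cos_bounds[OF fin ne s] by (intro cos_arccos)
    have c: "(\<Sum>p\<in>?P. ?V p * slice_query z ?V p) = of_real (cos (arccos ?c))"
      using search_state_query[OF fin ne s, of z] unfolding cos v_def .
    obtain a b where ab: "\<And>p. p \<in> ?P \<Longrightarrow> slice (\<Psi>2 z) 0 p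
        = of_real (g z) * (of_real a * ?V p + of_real b * slice_query z ?V p)"
      "a + cos (arccos ?c) * b = cos (of_nat k * arccos ?c)"
      using grover_iterates[OF fin vn c \<Psi>1_0[of _ z], where k = k] \<Psi>2[of 0 z] j by force
    have vv: "(\<Sum>p\<in>?P. ?V p * ?V p) = 1"
      using arg_cong[OF vn, of complex_of_real] by (simp add: power2_eq_square)
    have "(\<Sum>p\<in>?P. of_real (v p) * slice (\<Psi>2 z) 0 p)
      = (\<Sum>p\<in>?P. of_real (g z) * of_real a * (?V p * ?V p) + of_real (g z) * of_real b * (?V p * slice_query z ?V p))"
      by (intro sum.cong refl) (simp add: ab(1) algebra_simps)
    also have "\<dots> = of_real (g z) * of_real a + of_real (g z) * of_real b * of_real (cos (arccos ?c))"
      by (simp only: sum.distrib flip: sum_distrib_left) (simp only: c vv mult_1_right)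
    also have "\<dots> = of_real (g z * (a + cos (arccos ?c) * b))" by (simp add: algebra_simps)
    finally have ip: "(\<Sum>p\<in>?P. of_real (v p) * slice (\<Psi>2 z) 0 p)
      = of_real (g z * cos (of_nat k * arccos ?c))" unfolding ab(2) .
    \<comment> \<open>Row \<open>e\<close> of the reflection equals \<open>v\<close>, so undoing the
      preparation reads off the overlap with \<open>v\<close>; the extra term at \<open>e\<close> is
      cancelled by the subtracted identity.\<close>
    have "2 * of_real (u e) * (\<Sum>p\<in>?P. of_real (u p) * slice (\<Psi>2 z) 0 p)
      = (\<Sum>p\<in>?P. of_real (2 * (u p * u e)) * slice (\<Psi>2 z) 0 p)"
      by (simp add: sum_distrib_left mult_ac)
    also have "\<dots> = (\<Sum>p\<in>?P. (if p = e then slice (\<Psi>2 z) 0 e else 0) + of_real (v p) * slice (\<Psi>2 z) 0 p)"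
      unfolding ue by (intro sum.cong refl) (simp add: algebra_simps)
    also have "\<dots> = slice (\<Psi>2 z) 0 e + of_real (g z * cos (of_nat k * arccos ?c))"
      using e finP ip by (simp add: sum.distrib)
    finally show ?thesis
      using j by (simp add: \<Psi>3_def slice_apply_lift apply_op_reflection[OF finP e])
  qed
  \<comment> \<open>Exchanges slice 0 with slice \<open>Suc j\<close> everywhere except at
    \<open>e\<close>; as slice \<open>Suc j\<close> is still empty, only the multiple of
    \<open>e\<close> remains in slice 0.\<close>
  define \<pi> :: "'a label \<Rightarrow> 'a label" where
    "\<pi> = (\<lambda>(r, b, w). if (r, b) \<noteq> e \<and> w = 0 then (r, b, Suc j)
       else if (r, b) \<noteq> e \<and> w = Suc j then (r, b, 0) else (r, b, w))"
  have \<pi>: "\<pi> i \<in> basis S m \<and> \<pi> (\<pi> i) = i" if "i \<in> basis S m" for i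
    using that j by (auto simp: \<pi>_def basis_def split: if_splits)
  define \<Psi>4 where "\<Psi>4 z = apply_op (basis S m) (\<lambda>i k. if i = \<pi> k then 1 else 0) (\<Psi>3 z)" for z
  have prep4: "preparable S m st (T + k) \<Psi>4"
    unfolding \<Psi>4_def by (intro preparable.gate prep3 unitary_on_involution finite_basis fin \<pi>)
  have \<Psi>4: "\<Psi>4 z i = \<Psi>3 z (\<pi> i)" if "i \<in> basis S m" for z i
    unfolding \<Psi>4_def using that by (intro apply_op_involution finite_basis fin \<pi>)
  have "unsuccessful S m r0 (Suc j) (\<lambda>z. g z * cos (of_nat k * arccos (marked_cos S z s))) \<Psi>4"
    unfolding unsuccessful_def
  proof (intro conjI allI ballI impI)
    fix z and p :: "'a \<times> bool" assume p: "p \<in> ?P"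
    obtain r b where rb: "p = (r, b)" by fastforce
    have "(r, b, 0) \<in> basis S m" using p j by (auto simp: basis_def rb)
    then have "slice (\<Psi>4 z) 0 p = \<Psi>3 z (\<pi> (r, b, 0))" by (simp add: slice_def rb \<Psi>4)
    also have "\<dots> = (if p = e then slice (\<Psi>3 z) 0 e else slice (\<Psi>3 z) (Suc j) p)"
      by (auto simp: slice_def rb \<pi>_def)
    also have "\<dots> = (if p = e then slice (\<Psi>3 z) 0 e else 0)"
      using \<Psi>3_w[OF p, of "Suc j"] j by simp
    finally show "slice (\<Psi>4 z) 0 p = of_real (g z * cos (of_nat k * arccos (marked_cos S z s)))
        * (if p = (r0, False) then 1 else 0)"
      using \<Psi>3_e[of z] by (simp add: e_def)
  next
    fix z w and p :: "'a \<times> bool" assume p: "p \<in> ?P" and w: "Suc j < w \<and> w < m"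
    obtain r b where rb: "p = (r, b)" by fastforce
    have "(r, b, w) \<in> basis S m" using p w by (auto simp: basis_def rb)
    then have "slice (\<Psi>4 z) w p = slice (\<Psi>3 z) w p"
      using w by (simp add: slice_def rb \<Psi>4) (simp add: \<pi>_def)
    then show "slice (\<Psi>4 z) w p = 0" using \<Psi>3_w[OF p] w by simp
  qed
  then show ?thesis using prep4 by blast
qed

text \<open>Each search multiplies the unsuccessful amplitude by its own cosine and uses up one
  fresh slice, whence \<open>length ps < m\<close>.\<close>

lemma preparable_searches:
  assumes fin: "finite S" and r0: "r0 \<in> S"
    and s: "\<And>k s. (k, s) \<in> set ps \<Longrightarrow> 0 \<le> s \<and> s \<le> 1" and m: "length ps < m"
  shows "\<exists>\<Psi>. preparable S m (r0, False, 0) (\<Sum>(k, s)\<leftarrow>ps. k) \<Psi> \<and>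
    unsuccessful S m r0 (length ps)
      (\<lambda>z. \<Prod>(k, s)\<leftarrow>ps. cos (of_nat k * arccos (marked_cos S z s))) \<Psi>"
  using s m
proof (induction ps)
  case Nil
  show ?case
    by (intro exI[of _ "\<lambda>z i. if i = (r0, False, 0) then 1 else 0"] conjI)
       (auto simp: unsuccessful_def slice_def intro: preparable.start)
next
  case (Cons p ps)
  obtain k s where p: "p = (k, s)" by fastforce
  obtain \<Psi> where \<Psi>: "preparable S m (r0, False, 0) (\<Sum>(k, s)\<leftarrow>ps. k) \<Psi>"
    "unsuccessful S m r0 (length ps) (\<lambda>z. \<Prod>(k, s)\<leftarrow>ps. cos (of_nat k * arccos (marked_cos S z s))) \<Psi>"
    using Cons by fastforce
  have "0 \<le> s" "s \<le> 1" using Cons.prems(1)[of k s] p by auto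
  from preparable_search[OF fin r0 this \<Psi>, of k] Cons.prems(2)
  show ?case by (auto simp: p add.commute mult.commute)
qed

text \<open>Every outcome except the start state accepts, so by normalisation the rejection
  probability is the squared amplitude of the start state. With no marked sample all cosines are 1,
  which makes the error one-sided.\<close>

lemma query_alg_of_searches:
  assumes fin: "finite S" and ne: "S \<noteq> {}"
    and s: "\<And>k s. (k, s) \<in> set ps \<Longrightarrow> 0 \<le> s \<and> s \<le> 1"
  shows "\<exists>Q. query_alg S Q \<and> calls Q = (\<Sum>(k, s)\<leftarrow>ps. k) \<and>
    (\<forall>z. quantum_acceptance S Q z
       = 1 - (\<Prod>(k, s)\<leftarrow>ps. cos (of_nat k * arccos (marked_cos S z s)))\<^sup>2)"
proof -
  obtain r0 where r0: "r0 \<in> S" using ne by blast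
  define m where "m = Suc (length ps)"
  define st where "st = (r0, False, 0 :: nat)"
  define T where "T = (\<Sum>(k, s)\<leftarrow>ps. k)"
  let ?g = "\<lambda>z. \<Prod>(k, s)\<leftarrow>ps. cos (of_nat k * arccos (marked_cos S z s))"
  obtain \<Psi> where \<Psi>: "preparable S m st T \<Psi>" "unsuccessful S m r0 (length ps) ?g \<Psi>"
    using preparable_searches[OF fin r0, of ps m] s by (auto simp: m_def st_def T_def)
  obtain G where G: "\<And>k. unitary_on (basis S m) (G k)"
    "\<And>acc c z i. i \<in> basis S m \<Longrightarrow> state_after S
      \<lparr>workspace = m, start = st, gate = G, accepting = acc, calls = c\<rparr> z T i = \<Psi> z i"
    using preparable_imp_query_alg[OF fin \<Psi>(1)] by blast
  define Q where "Q = \<lparr>workspace = m, start = st, gate = G, accepting = basis S m - {st}, calls = T\<rparr>"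
  have st: "st \<in> basis S m" using r0 by (simp add: st_def basis_def m_def)
  have Q: "query_alg S Q" using st G(1) by (auto simp: query_alg_def Q_def)
  have "quantum_acceptance S Q z = 1 - (?g z)\<^sup>2" for z
  proof -
    have "quantum_acceptance S Q z = (\<Sum>i\<in>basis S m. (cmod (state_after S Q z T i))\<^sup>2)
        - (cmod (state_after S Q z T st))\<^sup>2"
      using st finite_basis[OF fin] by (simp add: quantum_acceptance_def Q_def sum_diff1)
    also have "(\<Sum>i\<in>basis S m. (cmod (state_after S Q z T i))\<^sup>2) = 1"
      using state_after_norm[OF fin Q, of T z] by (simp add: Q_def)
    also have "state_after S Q z T st = slice (\<Psi> z) 0 (r0, False)"
      using G(2)[OF st] by (simp add: Q_def slice_def st_def)
    also have "\<dots> = of_real (?g z)" using \<Psi>(2) r0 by (simp add: unsuccessful_def)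
    finally show ?thesis by simp
  qed
  then show ?thesis using Q by (intro exI[of _ Q]) (auto simp: Q_def T_def)
qed

section \<open>Sufficient calls\<close>

text \<open>A pair \<open>(k, s)\<close> stands for a search with \<open>k\<close> iterations and
  damping \<open>s\<close>; \<open>x\<close> is the marked fraction.\<close>

definition failure_amplitude :: "(nat \<times> real) list \<Rightarrow> real \<Rightarrow> real" where
  "failure_amplitude ps x = (\<Prod>(k, s)\<leftarrow>ps. cos (of_nat k * arccos (1 - 2 * s * x)))"

lemma failure_amplitude_append:
  "failure_amplitude (ps @ qs) x = failure_amplitude ps x * failure_amplitude qs x"
  by (simp add: failure_amplitude_def)

lemma abs_prod_list_le_1:
  fixes xs :: "real list"
  shows "(\<And>x. x \<in> set xs \<Longrightarrow> \<bar>x\<bar> \<le> 1) \<Longrightarrow> \<bar>prod_list xs\<bar> \<le> 1"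
proof (induction xs)
  case (Cons a xs)
  then have "\<bar>a\<bar> * \<bar>prod_list xs\<bar> \<le> 1 * 1" by (intro mult_mono) auto
  then show ?case by (simp add: abs_mult)
qed auto

lemma abs_failure_amplitude_le_1: "\<bar>failure_amplitude ps x\<bar> \<le> 1"
  unfolding failure_amplitude_def by (intro abs_prod_list_le_1) auto

lemma abs_prod_list_le_member:
  fixes xs :: "real list"
  assumes "\<And>x. x \<in> set xs \<Longrightarrow> \<bar>x\<bar> \<le> 1" "y \<in> set xs"
  shows "\<bar>prod_list xs\<bar> \<le> \<bar>y\<bar>"
proof -
  obtain as bs where xs: "xs = as @ y # bs" using split_list[OF assms(2)] by blast
  have "\<bar>prod_list as\<bar> \<le> 1" "\<bar>prod_list bs\<bar> \<le> 1"
    using assms(1) by (auto intro!: abs_prod_list_le_1 simp: xs)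
  then have "\<bar>prod_list as\<bar> * \<bar>prod_list bs\<bar> * \<bar>y\<bar> \<le> (1 * 1) * \<bar>y\<bar>"
    by (intro mult_right_mono mult_mono) auto
  then show ?thesis by (simp add: xs abs_mult mult_ac)
qed

text \<open>The acceptance probability depends on the black box only through the number of marked
  samples, so a bound for each weight \<open>k\<close> admissible for a true \<open>f x\<close>
  suffices. Such a weight is nonzero because \<open>q\<close> is positive; weight 0 is rejected with
  certainty.\<close>

lemma calls_suffice_searches:
  fixes q \<epsilon> :: real
  assumes fin: "finite S" and ne: "S \<noteq> {}" and q: "0 < q" and \<epsilon>: "0 \<le> \<epsilon>"
    and s: "\<And>k s. (k, s) \<in> set ps \<Longrightarrow> 0 \<le> s \<and> s \<le> 1"
    and fail: "\<And>k. 0 < k \<Longrightarrow> k \<le> card S \<Longrightarrow> q * card S \<le> real k \<Longrightarrow>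
      (failure_amplitude ps (real k / card S))\<^sup>2 \<le> \<epsilon>"
  shows "calls_suffice n S q \<epsilon> (\<Sum>(k, s)\<leftarrow>ps. k)"
proof -
  have n: "real (card S) > 0" using fin ne by (simp add: card_gt_0_iff)
  obtain Q where Q: "query_alg S Q" "calls Q = (\<Sum>(k, s)\<leftarrow>ps. k)"
    "\<And>z. quantum_acceptance S Q z
       = 1 - (\<Prod>(k, s)\<leftarrow>ps. cos (of_nat k * arccos (marked_cos S z s)))\<^sup>2"
    using query_alg_of_searches[OF fin ne, of ps] s by blast
  have acc: "quantum_acceptance S Q z
      = 1 - (failure_amplitude ps (real (card {r \<in> S. z r}) / card S))\<^sup>2" for z
    unfolding Q(3) failure_amplitude_def marked_cos_def by (simp add: mult.assoc)
  have "pq_computes 0 (1 - \<epsilon>) n (\<lambda>x. quantum_acceptance S Q (A x)) f"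
    if cl: "pq_computes 0 q n (classical_acceptance S A) f" for A f
    unfolding pq_computes_def
  proof (intro allI impI conjI)
    fix x :: "bool list" assume x: "length x = n"
    let ?k = "card {r \<in> S. A x r}"
    show "quantum_acceptance S Q (A x) \<le> 0" if "\<not> f x"
    proof -
      have "classical_acceptance S A x \<le> 0" using cl x that by (auto simp: pq_computes_def)
      then have "?k = 0" using n by (simp add: classical_acceptance_def divide_le_0_iff)
      then show ?thesis unfolding acc by (simp add: failure_amplitude_def case_prod_unfold map_replicate_const)
    qed
    show "1 - \<epsilon> \<le> quantum_acceptance S Q (A x)" if "f x"
    proof -
      have "q \<le> classical_acceptance S A x" using cl x that by (auto simp: pq_computes_def)
      then have k: "q * card S \<le> real ?k" using n by (simp add: classical_acceptance_def field_simps)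
      moreover have "0 < q * card S" using q n by simp
      ultimately have "0 < ?k" by linarith
      moreover have "?k \<le> card S" using fin by (intro card_mono) auto
      ultimately show ?thesis unfolding acc using fail[OF _ _ k] by simp
    qed
  qed
  then show ?thesis unfolding calls_suffice_def using Q(1,2) by blast
qed

text \<open>At the first \<open>i\<close> for which \<open>2 ^ i * \<alpha>\<close> reaches pi/3,
  doubling cannot have passed 2 pi/3, and between these angles the cosine is at most 1/2 in absolute
  value.\<close>

lemma ex_abs_cos_double_le_half:
  fixes \<alpha> :: real
  assumes "0 < \<alpha>" "\<alpha> \<le> pi / 2" "pi / 3 \<le> 2 ^ I * \<alpha>"
  shows "\<exists>i\<le>I. \<bar>cos (2 ^ i * \<alpha>)\<bar> \<le> 1 / 2"
proof -
  define i where "i = (LEAST i. pi / 3 \<le> 2 ^ i * \<alpha>)"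
  have i: "pi / 3 \<le> 2 ^ i * \<alpha>" "i \<le> I"
    unfolding i_def using assms(3) by (rule LeastI, rule Least_le)
  have up: "2 ^ i * \<alpha> \<le> 2 * pi / 3"
  proof (cases i)
    case (Suc j)
    then have "\<not> pi / 3 \<le> 2 ^ j * \<alpha>" unfolding i_def using not_less_Least by (metis lessI)
    then show ?thesis by (simp only: Suc power_Suc mult.assoc)
  next
    case 0
    then have "2 ^ i * \<alpha> = \<alpha>" by simp
    then show ?thesis using assms(2) pi_gt_zero by linarith
  qed
  have "cos (2 ^ i * \<alpha>) \<le> cos (pi / 3)" using i(1) up by (intro cos_monotone_0_pi_le) auto
  moreover have "cos (2 * pi / 3) \<le> cos (2 ^ i * \<alpha>)" using i(1) up assms(1) by (intro cos_monotone_0_pi_le) auto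
  ultimately have "\<bar>cos (2 ^ i * \<alpha>)\<bar> \<le> 1 / 2" by (simp add: cos_60 cos_120)
  then show ?thesis using i(2) by blast
qed

section \<open>Searches with doubling iteration counts\<close>

definition doubling_searches :: "nat \<Rightarrow> nat \<Rightarrow> (nat \<times> real) list" where
  "doubling_searches I R = concat (replicate R (map (\<lambda>i. (2 ^ i, 1 / 2)) [0..<Suc I]))"

lemma doubling_searches_calls: "(\<Sum>(k, s)\<leftarrow>doubling_searches I R. k) \<le> R * (2 * 2 ^ I)"
proof -
  have "(\<Sum>i\<leftarrow>[0..<Suc I]. 2 ^ i :: nat) \<le> 2 * 2 ^ I" by (induction I) auto
  then have "R * (\<Sum>i\<leftarrow>[0..<Suc I]. 2 ^ i) \<le> R * (2 * 2 ^ I)" by (rule mult_le_mono2)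
  moreover have "(\<Sum>(k, s)\<leftarrow>doubling_searches I R. k) = R * (\<Sum>i\<leftarrow>[0..<Suc I]. 2 ^ i)"
    unfolding doubling_searches_def by (induction R) (simp_all add: comp_def)
  ultimately show ?thesis by simp
qed

text \<open>The damping 1/2 gives cos \<alpha> = 1 - k/N, so \<alpha> is at most pi/2 and \<alpha>^2
  at least 2k/N. By the condition on \<open>I\<close> the largest angle
  \<open>2 ^ I * \<alpha>\<close> reaches pi/3, so each of the \<open>R\<close> rounds contains a
  factor of absolute value at most 1/2.\<close>

lemma doubling_searches_failure:
  assumes "0 < K" "K \<le> k" "k \<le> N" "sqrt (N / K) \<le> 2 ^ I"
  shows "(failure_amplitude (doubling_searches I R) (k / N))\<^sup>2 \<le> 1 / 2 ^ (2 * R)"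
proof -
  have N: "0 < N" using assms by simp
  define \<alpha> where "\<alpha> = arccos (1 - k / N)"
  have x: "0 < k / N" "k / N \<le> 1" using assms(1-3) N by auto
  have cos: "cos \<alpha> = 1 - k / N" unfolding \<alpha>_def using x by (intro cos_arccos) auto
  have \<alpha>: "0 \<le> \<alpha>" "\<alpha> \<le> pi / 2" unfolding \<alpha>_def
    by (rule arccos_lbound, use x in simp, use x in simp) (rule arccos_le_pi2, use x in simp, use x in simp)
  have "\<alpha> \<noteq> 0"
  proof
    assume "\<alpha> = 0"
    then have "cos \<alpha> = 1" by simp
    then show False using cos x(1) by linarith
  qed
  then have \<alpha>0: "0 < \<alpha>" using \<alpha> by simp
  have "k / N = 1 - cos \<alpha>" using cos by simp
  also have "\<dots> = 2 * (sin (\<alpha> / 2))\<^sup>2" using cos_double_sin[of "\<alpha> / 2"] by simp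
  also have "\<dots> \<le> 2 * (\<alpha> / 2)\<^sup>2"
    using \<alpha> by (intro mult_left_mono power_mono sin_x_le_x sin_ge_zero) auto
  also have "2 * (\<alpha> / 2)\<^sup>2 = \<alpha>\<^sup>2 / 2" by (simp add: power2_eq_square)
  finally have "2 * (k / N) \<le> \<alpha>\<^sup>2" by linarith
  moreover have "N / K \<le> (2 ^ I)\<^sup>2"
    using power_mono[OF assms(4), of 2] assms(1) N by simp
  ultimately have "(N / K) * (2 * (k / N)) \<le> (2 ^ I)\<^sup>2 * \<alpha>\<^sup>2"
    using x(1) by (intro mult_mono) simp_all
  moreover have "2 \<le> (N / K) * (2 * (k / N))" using assms(1,2) N by (simp add: field_simps)
  ultimately have "2 \<le> (2 ^ I * \<alpha>)\<^sup>2" by (simp add: power_mult_distrib)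
  \<comment> \<open>The rational number 4/3 separates pi/3 from sqrt 2.\<close>
  moreover have "(4 / 3)\<^sup>2 \<le> (2 :: real)" by (simp add: power2_eq_square)
  ultimately have "(4 / 3)\<^sup>2 \<le> (2 ^ I * \<alpha>)\<^sup>2" by linarith
  then have "4 / 3 \<le> 2 ^ I * \<alpha>" by (rule power2_le_imp_le) (use \<alpha>0 in simp)
  then have "pi / 3 \<le> 2 ^ I * \<alpha>" using pi_less_4 by linarith
  then obtain i where i: "i \<le> I" "\<bar>cos (2 ^ i * \<alpha>)\<bar> \<le> 1 / 2"
    using ex_abs_cos_double_le_half[OF \<alpha>0 \<alpha>(2)] by blast
  have round: "\<bar>failure_amplitude (map (\<lambda>i. (2 ^ i, 1 / 2)) [0..<Suc I]) (k / N)\<bar> \<le> 1 / 2"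
  proof -
    have "\<bar>prod_list (map (\<lambda>i. cos (2 ^ i * \<alpha>)) [0..<Suc I])\<bar> \<le> \<bar>cos (2 ^ i * \<alpha>)\<bar>"
      using i(1) by (intro abs_prod_list_le_member) (auto simp del: upt_Suc)
    then show ?thesis using i(2)
      by (simp add: failure_amplitude_def comp_def \<alpha>_def)
  qed
  have "\<bar>failure_amplitude (doubling_searches I R) (k / N)\<bar> \<le> (1 / 2) ^ R"
  proof (induction R)
    case 0
    then show ?case by (simp add: doubling_searches_def failure_amplitude_def)
  next
    case (Suc R)
    have "doubling_searches I (Suc R) = map (\<lambda>i. (2 ^ i, 1 / 2)) [0..<Suc I] @ doubling_searches I R"
      by (simp add: doubling_searches_def)
    then have "\<bar>failure_amplitude (doubling_searches I (Suc R)) (k / N)\<bar>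
        = \<bar>failure_amplitude (map (\<lambda>i. (2 ^ i, 1 / 2)) [0..<Suc I]) (k / N)\<bar>
          * \<bar>failure_amplitude (doubling_searches I R) (k / N)\<bar>"
      by (simp only: failure_amplitude_append abs_mult)
    also have "\<dots> \<le> (1 / 2) * (1 / 2) ^ R" by (intro mult_mono round Suc) auto
    finally show ?case by simp
  qed
  then have "\<bar>failure_amplitude (doubling_searches I R) (k / N)\<bar>\<^sup>2 \<le> ((1 / 2) ^ R)\<^sup>2"
    by (intro power_mono) auto
  then show ?thesis by (simp add: power_divide power_mult[symmetric] mult.commute)
qed

text \<open>For each weight \<open>k\<close> up to \<open>J\<close>, one search that never fails on
  it: \<open>s\<close> solves s k/N = sin^2(pi/(4m)), so the rotation angle is pi/(2m) and
  \<open>m\<close> iterations end exactly at pi/2.\<close>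

definition exact_searches :: "real \<Rightarrow> nat \<Rightarrow> (nat \<times> real) list" where
  "exact_searches N J = map (\<lambda>k :: nat. let m = nat \<lceil>sqrt (N / k)\<rceil> in
     (m, N / real k * (sin (pi / (4 * real m)))\<^sup>2)) [1..<Suc J]"

lemma nat_ceiling_sqrt_bounds:
  assumes "0 < k" "real k \<le> N"
  shows "sqrt (N / k) \<le> nat \<lceil>sqrt (N / k)\<rceil>" "nat \<lceil>sqrt (N / k)\<rceil> \<le> 2 * sqrt (N / k)"
    "0 < nat \<lceil>sqrt (N / k)\<rceil>"
proof -
  have "1 \<le> sqrt (N / k)" using assms by simp
  then show "sqrt (N / k) \<le> nat \<lceil>sqrt (N / k)\<rceil>" "nat \<lceil>sqrt (N / k)\<rceil> \<le> 2 * sqrt (N / k)"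
    "0 < nat \<lceil>sqrt (N / k)\<rceil>" by linarith+
qed

text \<open>The reason for rounding \<open>m\<close> up: sin(pi/(4m)) is at most 1/m, and m^2 is at
  least N/k, so the damping does not exceed 1.\<close>

lemma exact_searches_params:
  assumes "real J \<le> N" "(m, s) \<in> set (exact_searches N J)"
  shows "0 \<le> s \<and> s \<le> 1"
proof -
  obtain k where kJ: "k \<in> set [1..<Suc J]"
    and "(m, s) = (let m = nat \<lceil>sqrt (N / real k)\<rceil> in (m, N / real k * (sin (pi / (4 * real m)))\<^sup>2))"
    using assms(2) unfolding exact_searches_def set_map by (rule imageE)
  then have "m = nat \<lceil>sqrt (N / real k)\<rceil>" "s = N / real k * (sin (pi / (4 * real m)))\<^sup>2"
    by (simp_all only: Let_def prod.inject)
  moreover have "0 < k" "k \<le> J" using kJ by auto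
  ultimately have k: "0 < k" "k \<le> J" "m = nat \<lceil>sqrt (N / k)\<rceil>" "s = N / k * (sin (pi / (4 * real m)))\<^sup>2"
    by blast+
  have kN: "real k \<le> N" "0 < N" using k assms(1) by auto
  note m = nat_ceiling_sqrt_bounds[OF k(1) kN(1), folded k(3)]
  have "sin (pi / (4 * real m)) \<le> 1 / m"
  proof -
    have "sin (pi / (4 * real m)) \<le> pi / (4 * real m)" by (intro sin_x_le_x) simp
    also have "\<dots> \<le> 1 / m" using pi_less_4 m(3) by (simp add: field_simps)
    finally show ?thesis .
  qed
  moreover have "0 \<le> sin (pi / (4 * real m))"
  proof (intro sin_ge_zero)
    show "pi / (4 * real m) \<le> pi" using m(3) by (simp add: field_simps) 
  qed simp
  ultimately have "(sin (pi / (4 * real m)))\<^sup>2 \<le> (1 / m)\<^sup>2" by (intro power_mono)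
  moreover have "N / k \<le> (real m)\<^sup>2" using power_mono[OF m(1), of 2] kN by simp
  ultimately have "s \<le> (real m)\<^sup>2 * (1 / m)\<^sup>2" unfolding k(4) by (intro mult_mono) auto
  also have "\<dots> = 1" using m(3) by (simp add: power_divide)
  finally show ?thesis using kN k(4) by simp
qed

lemma exact_searches_failure:
  assumes "real J \<le> N" "0 < k" "k \<le> J"
  shows "failure_amplitude (exact_searches N J) (real k / N) = 0"
proof -
  have kN: "real k \<le> N" "0 < N" using assms by auto
  define m where "m = nat \<lceil>sqrt (N / k)\<rceil>"
  note m = nat_ceiling_sqrt_bounds(3)[OF assms(2) kN(1), folded m_def]
  define s where "s = N / k * (sin (pi / (4 * real m)))\<^sup>2"
  have "2 * s * (real k / N) = 2 * (sin (pi / (4 * real m)))\<^sup>2" using kN assms by (simp add: s_def)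
  then have "1 - 2 * s * (real k / N) = cos (2 * (pi / (4 * real m)))" by (simp only: cos_double_sin)
  moreover have "arccos (cos (2 * (pi / (4 * real m)))) = 2 * (pi / (4 * real m))"
    using m by (intro arccos_cos) (auto simp: field_simps)
  ultimately have "real m * arccos (1 - 2 * s * (real k / N)) = pi / 2" using m by simp
  then have "cos (real m * arccos (1 - 2 * s * (real k / N))) = 0" by (simp only: cos_pi_half)
  moreover have "(m, s) \<in> set (exact_searches N J)"
    using assms unfolding exact_searches_def set_map
    by (intro image_eqI[of _ _ k]) (auto simp: Let_def m_def s_def)
  ultimately show ?thesis
    unfolding failure_amplitude_def prod_list_zero_iff by force
qed

text \<open>Telescoping: the new term \<open>1 / ?b\<close> is at most
  \<open>2 * (?b - ?a)\<close>.\<close>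

lemma sum_inverse_sqrt_le: "(\<Sum>k\<leftarrow>[1..<Suc J]. 1 / sqrt (real k)) \<le> 2 * sqrt (real J)"
proof (induction J)
  case (Suc J)
  let ?a = "sqrt (real J)" and ?b = "sqrt (real (Suc J))"
  have b: "0 < ?b" "?a \<le> ?b" by simp_all
  have "(?b - ?a) * (2 * ?b) \<ge> (?b - ?a) * (?b + ?a)" using b by (intro mult_left_mono) simp_all
  moreover have "(?b - ?a) * (?b + ?a) = 1"
    by (simp add: algebra_simps flip: power2_eq_square)
  ultimately have "1 / ?b \<le> 2 * (?b - ?a)" using b by (simp add: field_simps)
  then show ?case using Suc by simp
qed simp

text \<open>Rounding sqrt(N/k) up at most doubles it, since k is at most N; the sum of the 1/sqrt k
  contributes another factor 2 sqrt J.\<close>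

lemma exact_searches_calls:
  assumes "real J \<le> N"
  shows "real (\<Sum>(k, s)\<leftarrow>exact_searches N J. k) \<le> 4 * sqrt (N * J)"
proof -
  have "real (\<Sum>(k, s)\<leftarrow>exact_searches N J. k) = (\<Sum>k\<leftarrow>[1..<Suc J]. real (nat \<lceil>sqrt (N / real k)\<rceil>))"
    by (simp add: exact_searches_def Let_def comp_def flip: sum_list_of_nat)
  also have "\<dots> \<le> (\<Sum>k\<leftarrow>[1..<Suc J]. 2 * sqrt N * (1 / sqrt (real k)))"
  proof (intro sum_list_mono)
    fix k assume "k \<in> set [1..<Suc J]"
    then show "real (nat \<lceil>sqrt (N / k)\<rceil>) \<le> 2 * sqrt N * (1 / sqrt (real k))"
      using nat_ceiling_sqrt_bounds(2)[of k N] assms by (auto simp: real_sqrt_divide)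
  qed
  also have "\<dots> = 2 * sqrt N * (\<Sum>k\<leftarrow>[1..<Suc J]. 1 / sqrt (real k))"
    by (simp only: sum_list_const_mult)
  also have "\<dots> \<le> 2 * sqrt N * (2 * sqrt (real J))"
    using assms by (intro mult_left_mono sum_inverse_sqrt_le) auto
  finally show ?thesis by (simp add: real_sqrt_mult)
qed

section \<open>Choice of parameters and number of calls\<close>

lemma ex_power_of_two_between:
  fixes x :: real
  assumes "1 \<le> x"
  shows "\<exists>i. x \<le> 2 ^ i \<and> 2 ^ i \<le> 2 * x"
proof -
  define i where "i = (LEAST i. x \<le> 2 ^ i)"
  have "\<exists>i. x \<le> 2 ^ i" using real_arch_pow[of 2 x] by (auto intro: less_imp_le)
  then have i: "x \<le> 2 ^ i" unfolding i_def by (rule LeastI_ex)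
  moreover have "2 ^ i \<le> 2 * x"
  proof (cases i)
    case (Suc j)
    then have "\<not> x \<le> 2 ^ j" unfolding i_def using not_less_Least by (metis lessI)
    then show ?thesis by (simp add: Suc)
  qed (use assms in simp)
  ultimately show ?thesis by blast
qed

text \<open>Rationalising the difference of roots leaves a denominator without cancellation, which
  the upper and the lower bound can compare with simpler roots.\<close>

lemma amplification_bound_eq:
  assumes "0 < log 2 (1 / \<epsilon>)" "0 \<le> q * N"
  shows "amplification_bound N q \<epsilon>
    = sqrt N * log 2 (1 / \<epsilon>) / (sqrt (log 2 (1 / \<epsilon>) + q * N) + sqrt (q * N))"
proof -
  let ?L = "log 2 (1 / \<epsilon>)" and ?a = "sqrt (log 2 (1 / \<epsilon>) + q * N)" and ?b = "sqrt (q * N)"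
  have "0 < ?a + ?b" using assms by (intro add_pos_nonneg) auto
  moreover have "(?a - ?b) * (?a + ?b) = ?L"
    using assms by (simp add: algebra_simps flip: power2_eq_square)
  ultimately have "?a - ?b = ?L / (?a + ?b)" by (simp add: field_simps)
  then show ?thesis by (simp add: amplification_bound_def)
qed

text \<open>The condition \<open>\<epsilon> \<le> \<delta>\<close> keeps \<open>L\<close> above the
  positive constant \<open>l\<close>, so rounding the number of rounds costs only a constant factor.
  The 12 is 4, from rounding iteration counts to powers of two and summing them, times 3, from
  comparing \<open>sqrt K\<close> with the denominator of \<open>B\<close>.\<close>

lemma sufficient_calls:
  fixes q \<epsilon> \<delta> :: real
  assumes \<delta>: "0 < \<delta>" "\<delta> < 1" and fin: "finite S" and ne: "S \<noteq> {}" and q: "0 < q" "q \<le> 1"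
    and \<epsilon>: "1 / 2 ^ card S \<le> \<epsilon>" "\<epsilon> \<le> \<delta>"
  shows "\<exists>T. calls_suffice n S q \<epsilon> T \<and>
    real T \<le> 12 * (2 + 1 / log 2 (1 / \<delta>)) * amplification_bound (real (card S)) q \<epsilon>"
proof -
  define N where "N = real (card S)"
  define L where "L = log 2 (1 / \<epsilon>)"
  define l where "l = log 2 (1 / \<delta>)"
  have N: "1 \<le> N" using fin ne by (simp add: N_def Suc_le_eq card_gt_0_iff)
  have "(0 :: real) < 1 / 2 ^ card S" by simp
  then have \<epsilon>0: "0 < \<epsilon>" using \<epsilon> by linarith
  have l: "0 < l" using \<delta> by (simp add: l_def)
  have lL: "l \<le> L" using \<epsilon> \<epsilon>0 \<delta> by (simp add: l_def L_def frac_le)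
  have L: "0 < L" using l lL by simp
  have \<epsilon>_eq: "\<epsilon> = 2 powr (- L)" using \<epsilon>0 by (simp add: L_def log_divide)
  \<comment> \<open>Here the smallest admissible error 2^(-N) enters; it makes \<open>K\<close> at
    most \<open>N\<close>.\<close>
  have LN: "L \<le> N"
  proof -
    have "2 powr (- N) \<le> 2 powr (- L)"
      using \<epsilon>(1) by (simp add: \<epsilon>_eq N_def powr_minus powr_realpow divide_inverse)
    then show ?thesis by simp
  qed
  define K where "K = max (q * N) L"
  have K: "0 < K" "K \<le> N" using L LN q N by (auto simp: K_def mult_le_cancel_right1)
  obtain I where I: "sqrt (N / K) \<le> 2 ^ I" "2 ^ I \<le> 2 * sqrt (N / K)"
    using ex_power_of_two_between[of "sqrt (N / K)"] K by auto
  \<comment> \<open>The failure probability after \<open>R\<close> rounds is at most 2^(-2R), so L/2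
    rounds, rounded up, are enough.\<close>
  define R where "R = nat \<lceil>L / 2\<rceil>"
  have R: "L / 2 \<le> R" "R \<le> L / 2 + 1" using L unfolding R_def by linarith+
  have pow: "1 / 2 ^ (2 * R) \<le> \<epsilon>"
  proof -
    have "2 powr (- (2 * real R)) \<le> 2 powr (- L)" using R by simp
    moreover have "2 powr (- (2 * real R)) = 1 / 2 ^ (2 * R)"
      using powr_realpow[of 2 "2 * R"] by (simp add: powr_minus divide_inverse)
    ultimately show ?thesis by (simp add: \<epsilon>_eq)
  qed
  have D: "real (\<Sum>(k, s)\<leftarrow>doubling_searches I R. k) \<le> 4 * (1 + 1 / l) * L * sqrt (N / K)"
  proof -
    \<comment> \<open>Absorbs the additive 1 from rounding.\<close>
    have "1 \<le> 1 / l * L" using l lL by simp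
    then have R': "R \<le> (1 + 1 / l) * L" using R L by (simp add: algebra_simps)
    have "real (\<Sum>(k, s)\<leftarrow>doubling_searches I R. k) \<le> real R * (2 * 2 ^ I)"
      using of_nat_mono[OF doubling_searches_calls[of I R], where 'a = real]
      by (simp only: of_nat_mult of_nat_power of_nat_numeral)
    also have "\<dots> \<le> (1 + 1 / l) * L * (2 * (2 * sqrt (N / K)))"
    proof (rule mult_mono[OF R'])
      show "2 * 2 ^ I \<le> 2 * (2 * sqrt (N / K))" using I(2) by simp
      show "0 \<le> (1 + 1 / l) * L" using l L by (intro mult_nonneg_nonneg) simp_all
    qed simp
    also have "\<dots> = 4 * (1 + 1 / l) * L * sqrt (N / K)" by simp
    finally show ?thesis .
  qed
  define B where "B = amplification_bound N q \<epsilon>"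
  have B: "B = sqrt N * L / (sqrt (L + q * N) + sqrt (q * N))"
    unfolding B_def L_def using L q N by (intro amplification_bound_eq) (auto simp: L_def)
  \<comment> \<open>The denominator of \<open>B\<close> is at most 2 sqrt K + sqrt K; the generous
    bound \<open>4 * K\<close> has a simple root.\<close>
  have BK: "L * sqrt (N / K) \<le> 3 * B"
  proof -
    have "sqrt (L + q * N) \<le> sqrt (4 * K)" "sqrt (q * N) \<le> sqrt K"
      using K q N by (auto simp: K_def)
    then have "sqrt (L + q * N) + sqrt (q * N) \<le> 3 * sqrt K" by (simp add: real_sqrt_mult)
    moreover have "0 < sqrt (L + q * N) + sqrt (q * N)"
      using L q N by (intro add_pos_nonneg) (auto intro: add_pos_nonneg)
    ultimately have "sqrt N * L / (3 * sqrt K) \<le> B"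
      unfolding B using L N K by (intro divide_left_mono) auto
    then show ?thesis using K by (simp add: real_sqrt_divide field_simps)
  qed
  have calls: "\<exists>T. calls_suffice n S q \<epsilon> T \<and> real T \<le> 4 * L * sqrt (N / K) + 4 * (1 + 1 / l) * L * sqrt (N / K)"
  proof (cases "L \<le> q * N")
    case True
    then have KqN: "K = q * N" by (simp add: K_def)
    have "calls_suffice n S q \<epsilon> (\<Sum>(k, s)\<leftarrow>doubling_searches I R. k)"
    proof (rule calls_suffice_searches[OF fin ne q(1)])
      show "0 \<le> s \<and> s \<le> 1" if "(k, s) \<in> set (doubling_searches I R)" for k s
        using that by (auto simp: doubling_searches_def split: if_splits)
      show "(failure_amplitude (doubling_searches I R) (real k / real (card S)))\<^sup>2 \<le> \<epsilon>"
        if "0 < k" "k \<le> card S" "q * real (card S) \<le> real k" for k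
        using doubling_searches_failure[OF K(1), of k N I R] that I(1) pow
        unfolding KqN N_def by linarith
    qed (use \<epsilon>0 in simp)
    moreover have "0 \<le> 4 * L * sqrt (N / K)" using L N K by simp
    ultimately show ?thesis using D by (intro exI[of _ "\<Sum>(k, s)\<leftarrow>doubling_searches I R. k"]) auto
  next
    case False
    then have KL: "K = L" by (simp add: K_def)
    \<comment> \<open>Weights up to \<open>J\<close> are handled exactly; any larger integer weight
      is at least \<open>L = K\<close> and falls to the doubling rounds.\<close>
    define J where "J = nat \<lfloor>L\<rfloor>"
    have J: "real J \<le> L" "\<And>k. J < k \<Longrightarrow> L \<le> real k" using L unfolding J_def by linarith+
    have JN: "real J \<le> N" using J LN by simp
    let ?ps = "exact_searches N J @ doubling_searches I R"
    have "calls_suffice n S q \<epsilon> (\<Sum>(k, s)\<leftarrow>?ps. k)"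
    proof (rule calls_suffice_searches[OF fin ne q(1)])
      show "0 \<le> s \<and> s \<le> 1" if "(k, s) \<in> set ?ps" for k s
        using that exact_searches_params[OF JN] by (auto simp: doubling_searches_def split: if_splits)
      show "(failure_amplitude ?ps (real k / real (card S)))\<^sup>2 \<le> \<epsilon>"
        if k: "0 < k" "k \<le> card S" "q * real (card S) \<le> real k" for k
      proof (cases "k \<le> J")
        case True
        then show ?thesis using exact_searches_failure[OF JN k(1)] \<epsilon>0
          by (simp add: failure_amplitude_append N_def)
      next
        case False
        have "(failure_amplitude (doubling_searches I R) (real k / N))\<^sup>2 \<le> \<epsilon>"
          using doubling_searches_failure[OF K(1), of k N I R] J(2)[of k] False k(2) I(1) pow
          unfolding KL N_def by linarith
        moreover have "(failure_amplitude (exact_searches N J) (real k / N))\<^sup>2 \<le> 1"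
          using abs_failure_amplitude_le_1 by (simp add: abs_square_le_1)
        ultimately have "(failure_amplitude (exact_searches N J) (real k / N))\<^sup>2
          * (failure_amplitude (doubling_searches I R) (real k / N))\<^sup>2 \<le> 1 * \<epsilon>"
          by (intro mult_mono) auto
        then show ?thesis by (simp add: failure_amplitude_append power_mult_distrib N_def)
      qed
    qed (use \<epsilon>0 in simp)
    moreover have "real (\<Sum>(k, s)\<leftarrow>?ps. k) \<le> 4 * L * sqrt (N / K) + 4 * (1 + 1 / l) * L * sqrt (N / K)"
    proof -
      have "sqrt (N * J) \<le> sqrt (N * L)" using J N by (simp add: mult_left_mono)
      also have "\<dots> = L * sqrt (N / K)"
        using L by (simp add: KL real_sqrt_divide real_sqrt_mult field_simps)
      finally show ?thesis using exact_searches_calls[OF JN] D by simp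
    qed
    ultimately show ?thesis by blast
  qed
  have "4 * L * sqrt (N / K) + 4 * (1 + 1 / l) * L * sqrt (N / K) = 4 * (2 + 1 / l) * (L * sqrt (N / K))"
    by (simp add: algebra_simps)
  also have "\<dots> \<le> 4 * (2 + 1 / l) * (3 * B)" using BK l by (intro mult_left_mono) auto
  also have "\<dots> = 12 * (2 + 1 / l) * B" by simp
  finally show ?thesis using calls unfolding l_def B_def N_def by force
qed

section \<open>Polynomials bounded on an interval\<close>

text \<open>
  The Joukowski-type map \<open>w \<mapsto> J w / w\<close> sends the unit circle onto \<open>[y, 1]\<close> and \<open>-\<rho>\<close> to 0; apply the
  maximum principle to \<open>w ^ d * p (J w / w)\<close>, which is a polynomial in \<open>w\<close>.
\<close>

lemma norm_poly_zero_le_of_bound_on_interval: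
  fixes p :: "complex poly" and y M :: real
  assumes deg: "degree p \<le> d" and y: "0 < y" "y < 1"
    and bd: "\<And>x. y \<le> x \<Longrightarrow> x \<le> 1 \<Longrightarrow> cmod (poly p (of_real x)) \<le> M"
  shows "cmod (poly p 0) \<le> M * ((1 + sqrt y) / (1 - sqrt y)) ^ d"
proof -
  define u where "u = sqrt y"
  have u: "0 < u" "u < 1" "y = u\<^sup>2" using y by (auto simp: u_def)
  define \<rho> where "\<rho> = (1 - u) / (1 + u)"
  have rho: "0 < \<rho>" "\<rho> < 1" using u by (auto simp: \<rho>_def field_simps)
  define J :: "complex \<Rightarrow> complex" where
    "J w = w * of_real ((1 + y) / 2) + of_real ((1 - y) / 4) * (w\<^sup>2 + 1)" for w
  define g :: "complex \<Rightarrow> complex" where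
    "g w = (\<Sum>k\<le>d. coeff p k * w ^ (d - k) * J w ^ k)" for w
  have g_eq: "g w = w ^ d * poly p (J w / w)" if "w \<noteq> 0" for w
  proof -
    have "poly p (J w / w) = (\<Sum>k\<le>d. coeff p k * (J w / w) ^ k)"
      unfolding poly_altdef using deg
      by (intro sum.mono_neutral_left) (auto simp: coeff_eq_0)
    then have "w ^ d * poly p (J w / w) = (\<Sum>k\<le>d. w ^ d * (coeff p k * (J w / w) ^ k))"
      by (simp add: sum_distrib_left)
    also have "\<dots> = g w"
      unfolding g_def
    proof (intro sum.cong refl)
      fix k assume "k \<in> {..d}"
      then have "w ^ d = w ^ (d - k) * w ^ k" by (simp flip: power_add)
      then show "w ^ d * (coeff p k * (J w / w) ^ k) = coeff p k * w ^ (d - k) * J w ^ k"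
        using that by (simp add: power_divide)
    qed
    finally show ?thesis by simp
  qed
  have holo: "g holomorphic_on UNIV"
    unfolding g_def J_def by (intro holomorphic_intros)
  have circle: "cmod (g w) \<le> M" if w: "cmod w = 1" for w
  proof -
    have w0: "w \<noteq> 0" using w by auto
    \<comment> \<open>On the unit circle w + 1/w = 2 Re w, so \<open>J w / w\<close> is this real
      number.\<close>
    define x where "x = (1 + y) / 2 + (1 - y) / 2 * Re w"
    have "\<bar>Re w\<bar> \<le> 1" using abs_Re_le_cmod[of w] w by simp
    then have "(1 - y) / 2 * Re w \<le> (1 - y) / 2 * 1" "(1 - y) / 2 * (- 1) \<le> (1 - y) / 2 * Re w"
      using y by (intro mult_left_mono; simp)+
    then have x: "y \<le> x" "x \<le> 1" unfolding x_def by (simp_all add: field_simps)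
    have "w * cnj w = 1" using w by (simp flip: complex_norm_square)
    then have "w\<^sup>2 + 1 = w * (w + cnj w)" by (simp add: power2_eq_square algebra_simps)
    also have "\<dots> = w * of_real (2 * Re w)" by (simp add: complex_add_cnj)
    finally have "J w = w * of_real x"
      unfolding J_def x_def by (simp add: field_simps)
    then have "g w = w ^ d * poly p (of_real x)" using g_eq[OF w0] w0 by simp
    then show ?thesis using bd[OF x] w by (simp add: norm_mult norm_power)
  qed
  have "cmod (g (- of_real \<rho>)) \<le> M"
  proof (rule maximum_modulus_frontier[of g "cball 0 1"])
    show "g holomorphic_on interior (cball 0 1)" using holo holomorphic_on_subset by blast
    show "continuous_on (closure (cball 0 1)) g"
      using holo holomorphic_on_imp_continuous_on continuous_on_subset by blast
    show "bounded (cball (0::complex) 1)" by simp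
    show "\<And>z. z \<in> frontier (cball 0 1) \<Longrightarrow> cmod (g z) \<le> M" using circle by (auto simp: frontier_def)
    show "- of_real \<rho> \<in> cball (0::complex) 1" using rho by simp
  qed
  moreover have "J (- of_real \<rho>) = 0"
  proof -
    have "- \<rho> * ((1 + y) / 2) + (1 - y) / 4 * (\<rho>\<^sup>2 + 1) = 0"
    proof -
      have "\<rho> * (1 + u) = 1 - u" using u by (simp add: \<rho>_def)
      \<comment> \<open>Multiplying by \<open>(1 + u)\<^sup>2\<close> clears the denominators of
        \<rho>; what remains is a polynomial identity in \<open>u\<close>.\<close>
      moreover have "(1 + u)\<^sup>2 * (- \<rho> * ((1 + y) / 2) + (1 - y) / 4 * (\<rho>\<^sup>2 + 1))
        = - (\<rho> * (1 + u)) * (1 + u) * (1 + y) / 2 + (1 - y) / 4 * ((\<rho> * (1 + u))\<^sup>2 + (1 + u)\<^sup>2)"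
        by (simp add: power2_eq_square field_simps)
      ultimately have "(1 + u)\<^sup>2 * (- \<rho> * ((1 + y) / 2) + (1 - y) / 4 * (\<rho>\<^sup>2 + 1))
        = - (1 - u) * (1 + u) * (1 + u\<^sup>2) / 2 + (1 - u\<^sup>2) / 4 * ((1 - u)\<^sup>2 + (1 + u)\<^sup>2)"
        by (simp add: u(3))
      also have "\<dots> = 0" by (simp add: power2_eq_square field_simps)
      finally show ?thesis using u by auto
    qed
    then have "complex_of_real (- \<rho> * ((1 + y) / 2) + (1 - y) / 4 * (\<rho>\<^sup>2 + 1)) = 0" by simp
    then show ?thesis unfolding J_def by (simp only: of_real_add of_real_mult of_real_minus of_real_power power2_minus of_real_1)
  qed
  ultimately have "\<rho> ^ d * cmod (poly p 0) \<le> M"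
    using g_eq[of "- of_real \<rho>"] rho by (simp add: norm_mult norm_power)
  then have "cmod (poly p 0) \<le> M / \<rho> ^ d" using rho by (simp add: field_simps)
  also have "\<dots> = M * (1 / \<rho>) ^ d" by (simp add: power_one_over field_simps)
  also have "1 / \<rho> = (1 + sqrt y) / (1 - sqrt y)" by (simp add: \<rho>_def u_def)
  finally show ?thesis .
qed

section \<open>Acceptance probabilities as polynomials\<close>

text \<open>Polynomials in the indicators of \<open>z r\<close>, with at most \<open>d\<close>
  samples per monomial; indicators are idempotent, so no powers occur. Generating them monomial by
  monomial lets the closure properties follow by induction.\<close>

inductive multilinear :: "'r set \<Rightarrow> nat \<Rightarrow> (('r \<Rightarrow> bool) \<Rightarrow> complex) \<Rightarrow> bool" for S d where
  zero: "multilinear S d (\<lambda>z. 0)"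
| add_monomial: "A \<subseteq> S \<Longrightarrow> card A \<le> d \<Longrightarrow> multilinear S d F \<Longrightarrow>
    multilinear S d (\<lambda>z. c * of_bool (\<forall>r\<in>A. z r) + F z)"

lemma multilinear_monomial:
  "A \<subseteq> S \<Longrightarrow> card A \<le> d \<Longrightarrow> multilinear S d (\<lambda>z. c * of_bool (\<forall>r\<in>A. z r))"
  using multilinear.add_monomial[OF _ _ multilinear.zero] by simp

lemma multilinear_const: "multilinear S d (\<lambda>z. c)"
  using multilinear_monomial[of "{}" S d c] by simp

lemma multilinear_indicator: "r \<in> S \<Longrightarrow> multilinear S (Suc 0) (\<lambda>z. of_bool (z r))"
  using multilinear_monomial[of "{r}" S "Suc 0" 1] by simp

lemma multilinear_add:
  assumes "multilinear S d F" "multilinear S d G"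
  shows "multilinear S d (\<lambda>z. F z + G z)"
  using assms(1)
proof induction
  case (add_monomial A F c)
  then show ?case using multilinear.add_monomial[of A S d "\<lambda>z. F z + G z" c] by (simp add: add.assoc)
qed (use assms(2) in simp)

lemma multilinear_scale: "multilinear S d F \<Longrightarrow> multilinear S d (\<lambda>z. c * F z)"
proof (induction rule: multilinear.induct)
  case (add_monomial A F b)
  then show ?case
    using multilinear.add_monomial[of A S d "\<lambda>z. c * F z" "c * b"] by (simp add: algebra_simps)
qed (simp add: multilinear.zero)

lemma multilinear_sum:
  "(\<And>i. i \<in> B \<Longrightarrow> multilinear S d (F i)) \<Longrightarrow> multilinear S d (\<lambda>z. \<Sum>i\<in>B. F i z)"
  by (induction B rule: infinite_finite_induct) (auto intro: multilinear_add multilinear_const)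

lemma multilinear_cnj: "multilinear S d F \<Longrightarrow> multilinear S d (\<lambda>z. cnj (F z))"
proof (induction rule: multilinear.induct)
  case (add_monomial A F c)
  moreover have "cnj (of_bool P) = of_bool P" for P by (cases P) simp_all
  ultimately show ?case
    using multilinear.add_monomial[of A S d "\<lambda>z. cnj (F z)" "cnj c"] by simp
qed (simp add: multilinear.zero)

text \<open>The monomials over \<open>A\<close> and \<open>B\<close> multiply to the monomial over
  \<open>A \<union> B\<close>, whose size is at most \<open>d + e\<close>.\<close>

lemma multilinear_mult:
  assumes F: "multilinear S d F" and G: "multilinear S e G"
  shows "multilinear S (d + e) (\<lambda>z. F z * G z)"
  using F
proof induction
  case zero
  show ?case by (simp add: multilinear.zero)
next
  case (add_monomial A F c)
  have "multilinear S (d + e) (\<lambda>z. of_bool (\<forall>r\<in>A. z r) * G z)"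
    using G
  proof induction
    case zero
    show ?case by (simp add: multilinear.zero)
  next
    case (add_monomial B G c)
    have "card (A \<union> B) \<le> d + e"
      using card_Un_le[of A B] add_monomial(2) \<open>card A \<le> d\<close> by linarith
    then have "multilinear S (d + e) (\<lambda>z. c * of_bool (\<forall>r\<in>A \<union> B. z r) + of_bool (\<forall>r\<in>A. z r) * G z)"
      using add_monomial \<open>A \<subseteq> S\<close> by (intro multilinear.add_monomial) auto
    moreover have "of_bool (\<forall>r\<in>A. z r) * (c * of_bool (\<forall>r\<in>B. z r) + G z)
        = c * of_bool (\<forall>r\<in>A \<union> B. z r) + of_bool (\<forall>r\<in>A. z r) * G z" for z
      by (simp add: of_bool_def ball_Un)
    ultimately show ?case by simp
  qed
  from multilinear_add[OF multilinear_scale[OF this, of c] add_monomial(4)]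
  show ?case by (simp add: algebra_simps)
qed

text \<open>An amplitude after a query is 1 - z(r) times the old one plus z(r) times the one with
  flipped answer bit, so each query raises the degree by one. The gates only form linear
  combinations with fixed coefficients.\<close>

lemma multilinear_state_after:
  assumes "finite S"
  shows "i \<in> basis S (workspace Q) \<Longrightarrow> multilinear S k (\<lambda>z. state_after S Q z k i)"
proof (induction k arbitrary: i)
  case 0
  show ?case by (simp add: multilinear_const)
next
  case (Suc k)
  have "multilinear S (Suc k) (\<lambda>z. query_gate z (state_after S Q z k) j)"
    if j: "j \<in> basis S (workspace Q)" for j
  proof -
    obtain r b w where rbw: "j = (r, b, w)" "r \<in> S" "w < workspace Q" using j by (auto simp: basis_def)
    then have in_basis: "(r, b', w) \<in> basis S (workspace Q)" for b' by (simp add: basis_def)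
    have "multilinear S (k + Suc 0) (\<lambda>z. state_after S Q z k (r, b, w) * (1 + (-1) * of_bool (z r))
        + state_after S Q z k (r, \<not> b, w) * of_bool (z r))"
      by (intro multilinear_add multilinear_mult Suc.IH in_basis multilinear_indicator rbw
          multilinear_const multilinear_scale)
    moreover have "query_gate z (state_after S Q z k) j
      = state_after S Q z k (r, b, w) * (1 + (-1) * of_bool (z r))
        + state_after S Q z k (r, \<not> b, w) * of_bool (z r)" for z
      by (cases "z r") (simp_all add: query_gate_def rbw)
    ultimately show ?thesis by simp
  qed
  then show ?case
    by (simp add: apply_op_def) (intro multilinear_sum multilinear_scale)
qed

text \<open>An amplitude times its conjugate has twice the degree.\<close>

lemma multilinear_quantum_acceptance:
  assumes "finite S" "query_alg S Q"
  shows "multilinear S (2 * calls Q) (\<lambda>z. of_real (quantum_acceptance S Q z))"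
proof -
  have "multilinear S (calls Q + calls Q) (\<lambda>z. \<Sum>i\<in>accepting Q.
      state_after S Q z (calls Q) i * cnj (state_after S Q z (calls Q) i))"
    using assms
    by (intro multilinear_sum multilinear_mult multilinear_cnj multilinear_state_after)
       (auto simp: query_alg_def)
  then show ?thesis
    by (simp only: quantum_acceptance_def of_real_sum complex_norm_square flip: mult_2)
qed

lemma quantum_acceptance_bounds:
  assumes "finite S" "query_alg S Q"
  shows "0 \<le> quantum_acceptance S Q z" "quantum_acceptance S Q z \<le> 1"
proof -
  show "0 \<le> quantum_acceptance S Q z" by (simp add: quantum_acceptance_def sum_nonneg)
  have "quantum_acceptance S Q z \<le> (\<Sum>i\<in>basis S (workspace Q). (cmod (state_after S Q z (calls Q) i))\<^sup>2)"
    using assms finite_basis unfolding quantum_acceptance_def query_alg_def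
    by (intro sum_mono2) auto
  then show "quantum_acceptance S Q z \<le> 1" using state_after_norm[OF assms, of "calls Q" z] by simp
qed

section \<open>Averaging over independently marked samples\<close>

definition bernoulli_weight :: "'r set \<Rightarrow> real \<Rightarrow> 'r set \<Rightarrow> real" where
  "bernoulli_weight S x Z = x ^ card Z * (1 - x) ^ card (S - Z)"

lemma sum_subsets_powers:
  fixes a b :: "'a :: comm_semiring_1"
  assumes "finite S"
  shows "(\<Sum>Z\<in>Pow S. a ^ card Z * b ^ card (S - Z)) = (a + b) ^ card S"
  using prod_add[OF assms, of "\<lambda>_. a" "\<lambda>_. b"] by simp

lemma sum_bernoulli_weight: "finite S \<Longrightarrow> (\<Sum>Z\<in>Pow S. bernoulli_weight S x Z) = 1"
  by (simp add: bernoulli_weight_def sum_subsets_powers)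

lemma bernoulli_weight_nonneg: "0 \<le> x \<Longrightarrow> x \<le> 1 \<Longrightarrow> 0 \<le> bernoulli_weight S x Z"
  by (simp add: bernoulli_weight_def)

text \<open>The sum expands a product over all samples: a sample in \<open>A\<close> contributes
  only when marked, with factor \<open>x\<close>; any other contributes x + (1 - x) = 1.\<close>

lemma bernoulli_expectation_monomial:
  assumes fin: "finite S" and A: "A \<subseteq> S"
  shows "(\<Sum>Z\<in>Pow S. bernoulli_weight S x Z * of_bool (A \<subseteq> Z)) = x ^ card A"
proof -
  have "(\<Sum>Z\<in>Pow S. bernoulli_weight S x Z * of_bool (A \<subseteq> Z))
    = (\<Sum>Z\<in>Pow S. (\<Prod>r\<in>Z. x) * (\<Prod>r\<in>S - Z. (1 - x) * of_bool (r \<notin> A)))"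
  proof (intro sum.cong refl)
    fix Z assume Z: "Z \<in> Pow S"
    have "(\<Prod>r\<in>S - Z. of_bool (r \<notin> A)) = (of_bool (A \<subseteq> Z) :: real)"
    proof (cases "A \<subseteq> Z")
      case False
      then obtain r where "r \<in> A" "r \<notin> Z" by blast
      then have "(\<Prod>r\<in>S - Z. of_bool (r \<notin> A)) = (0 :: real)" using A fin by (intro prod_zero bexI[of _ r]) auto
      then show ?thesis using False by simp
    next
      case True
      then have "(\<Prod>r\<in>S - Z. of_bool (r \<notin> A)) = (1 :: real)" by (intro prod.neutral) auto
      then show ?thesis using True by simp
    qed
    then show "bernoulli_weight S x Z * of_bool (A \<subseteq> Z)
      = (\<Prod>r\<in>Z. x) * (\<Prod>r\<in>S - Z. (1 - x) * of_bool (r \<notin> A))"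
      by (simp add: bernoulli_weight_def prod.distrib)
  qed
  also have "\<dots> = (\<Prod>r\<in>S. x + (1 - x) * of_bool (r \<notin> A))" by (rule prod_add[OF fin, symmetric])
  also have "\<dots> = (\<Prod>r\<in>S. if r \<in> A then x else 1)" by (intro prod.cong) auto
  also have "\<dots> = x ^ card A" using fin A by (simp add: prod.If_cases inf.absorb2)
  finally show ?thesis .
qed

text \<open>By independence a monomial over \<open>A\<close> has expectation
  \<open>x ^ card A\<close>, so the degree bound survives the passage to one variable.\<close>

lemma multilinear_expectation_poly:
  assumes "finite S" "multilinear S d F"
  shows "\<exists>p. degree p \<le> d \<and>
    (\<forall>x. (\<Sum>Z\<in>Pow S. of_real (bernoulli_weight S x Z) * F (\<lambda>r. r \<in> Z)) = poly p (of_real x))"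
  using assms(2)
proof induction
  case zero
  show ?case by (intro exI[of _ 0]) simp
next
  case (add_monomial A F c)
  then obtain p where p: "degree p \<le> d"
    "\<And>x. (\<Sum>Z\<in>Pow S. of_real (bernoulli_weight S x Z) * F (\<lambda>r. r \<in> Z)) = poly p (of_real x)" by blast
  have "(\<Sum>Z\<in>Pow S. of_real (bernoulli_weight S x Z) * (c * of_bool (\<forall>r\<in>A. r \<in> Z) + F (\<lambda>r. r \<in> Z)))
      = poly (monom c (card A) + p) (of_real x)" for x
  proof -
    have "(\<Sum>Z\<in>Pow S. of_real (bernoulli_weight S x Z) * (c * of_bool (\<forall>r\<in>A. r \<in> Z) + F (\<lambda>r. r \<in> Z)))
      = (\<Sum>Z\<in>Pow S. c * of_real (bernoulli_weight S x Z * of_bool (A \<subseteq> Z))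
        + of_real (bernoulli_weight S x Z) * F (\<lambda>r. r \<in> Z))"
      by (intro sum.cong refl) (simp add: distrib_left subset_eq mult.left_commute)
    also have "\<dots> = c * of_real (\<Sum>Z\<in>Pow S. bernoulli_weight S x Z * of_bool (A \<subseteq> Z))
        + (\<Sum>Z\<in>Pow S. of_real (bernoulli_weight S x Z) * F (\<lambda>r. r \<in> Z))"
      by (simp only: sum.distrib sum_distrib_left of_real_sum)
    finally show ?thesis
      using bernoulli_expectation_monomial[OF assms(1) add_monomial(1)] p(2) by (simp add: poly_monom)
  qed
  moreover have "degree (monom c (card A) + p) \<le> d"
    using degree_monom_le[of c "card A"] add_monomial(2) p(1) by (intro degree_add_le) auto
  ultimately show ?case by blast
qed

definition lower_tail :: "'r set \<Rightarrow> real \<Rightarrow> real \<Rightarrow> real" where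
  "lower_tail S s x = (\<Sum>Z\<in>Pow S. bernoulli_weight S x Z * of_bool (real (card Z) < s))"

text \<open>The exponential moment method: the indicator of \<open>card Z < s\<close> is at most
  \<open>a powr (card Z - s)\<close>, whose expectation is a binomial sum.\<close>

lemma lower_tail_le:
  assumes "finite S" "0 < a" "a \<le> 1" "0 \<le> x" "x \<le> 1"
  shows "lower_tail S s x \<le> a powr (- s) * (1 - x * (1 - a)) ^ card S"
proof -
  have "lower_tail S s x \<le> (\<Sum>Z\<in>Pow S. a powr (- s) * ((a * x) ^ card Z * (1 - x) ^ card (S - Z)))"
    unfolding lower_tail_def
  proof (intro sum_mono)
    fix Z :: "'a set"
    have "of_bool (real (card Z) < s) \<le> a powr (real (card Z) - s)"
    proof (cases "real (card Z) < s")
      case True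
      have "a powr 0 \<le> a powr (real (card Z) - s)" using True assms by (intro powr_mono') auto
      then show ?thesis using True assms by simp
    qed simp
    then have "bernoulli_weight S x Z * of_bool (real (card Z) < s)
        \<le> bernoulli_weight S x Z * a powr (real (card Z) - s)"
      using bernoulli_weight_nonneg[OF assms(4,5)] by (intro mult_left_mono) auto
    also have "a powr (real (card Z) - s) = a powr (- s) * a ^ card Z"
      using assms(2) by (simp add: powr_realpow powr_add[symmetric] flip: powr_realpow)
    finally show "bernoulli_weight S x Z * of_bool (real (card Z) < s)
        \<le> a powr (- s) * ((a * x) ^ card Z * (1 - x) ^ card (S - Z))"
      by (simp add: bernoulli_weight_def power_mult_distrib mult_ac)
  qed
  also have "\<dots> = a powr (- s) * (a * x + (1 - x)) ^ card S"
    by (simp only: sum_subsets_powers[OF assms(1)] flip: sum_distrib_left)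
  also have "a * x + (1 - x) = 1 - x * (1 - a)" by (simp add: algebra_simps)
  finally show ?thesis .
qed

text \<open>The expected rejection probability is 1 at 0 and at most
  \<open>\<epsilon> + (1 - \<epsilon>) * b\<close> on the interval from \<open>y\<close> to 1; the
  extrapolation bound for polynomials links the two.\<close>

lemma one_le_error_times_growth:
  assumes fin: "finite S" and Q: "query_alg S Q" and \<epsilon>: "0 \<le> \<epsilon>" "\<epsilon> \<le> 1"
    and rej: "quantum_acceptance S Q (\<lambda>_. False) = 0"
    and acc: "\<And>Z. Z \<subseteq> S \<Longrightarrow> s \<le> real (card Z) \<Longrightarrow> 1 - \<epsilon> \<le> quantum_acceptance S Q (\<lambda>r. r \<in> Z)"
    and y: "0 < y" "y < 1"
    and tail: "\<And>x. y \<le> x \<Longrightarrow> x \<le> 1 \<Longrightarrow> lower_tail S s x \<le> b"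
  shows "1 \<le> (\<epsilon> + (1 - \<epsilon>) * b) * ((1 + sqrt y) / (1 - sqrt y)) ^ (2 * calls Q)"
proof -
  let ?F = "\<lambda>z. 1 - quantum_acceptance S Q z"
  have ml: "multilinear S (2 * calls Q) (\<lambda>z. 1 + (-1) * of_real (quantum_acceptance S Q z))"
    by (intro multilinear_add multilinear_const multilinear_scale multilinear_quantum_acceptance fin Q)
  obtain p :: "complex poly" where p: "degree p \<le> 2 * calls Q"
    "\<And>x. (\<Sum>Z\<in>Pow S. of_real (bernoulli_weight S x Z)
        * (1 + (-1) * of_real (quantum_acceptance S Q (\<lambda>r. r \<in> Z)))) = poly p (of_real x)"
    using multilinear_expectation_poly[OF fin ml] by blast
  have p_eq: "poly p (of_real x) = of_real (\<Sum>Z\<in>Pow S. bernoulli_weight S x Z * ?F (\<lambda>r. r \<in> Z))" for x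
    unfolding p(2)[symmetric] by simp
  have "cmod (poly p (of_real x)) \<le> \<epsilon> + (1 - \<epsilon>) * b" if x: "y \<le> x" "x \<le> 1" for x
  proof -
    have x01: "0 \<le> x" "x \<le> 1" using x y by auto
    have "0 \<le> (\<Sum>Z\<in>Pow S. bernoulli_weight S x Z * ?F (\<lambda>r. r \<in> Z))"
      using quantum_acceptance_bounds[OF fin Q] bernoulli_weight_nonneg[OF x01]
      by (intro sum_nonneg mult_nonneg_nonneg) auto
    then have "cmod (poly p (of_real x)) = (\<Sum>Z\<in>Pow S. bernoulli_weight S x Z * ?F (\<lambda>r. r \<in> Z))"
      unfolding p_eq by (simp only: norm_of_real abs_of_nonneg)
    also have "\<dots> \<le> (\<Sum>Z\<in>Pow S. \<epsilon> * bernoulli_weight S x Z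
        + (1 - \<epsilon>) * (bernoulli_weight S x Z * of_bool (real (card Z) < s)))"
    proof (intro sum_mono)
      fix Z assume "Z \<in> Pow S"
      \<comment> \<open>Sets with at least \<open>s\<close> elements are rejected with probability
        at most \<epsilon>. For smaller ones the bound is 1, and writing it as \<epsilon> + (1 -
        \<epsilon>) keeps the estimate sharp for \<epsilon> near 1.\<close>
      then have "?F (\<lambda>r. r \<in> Z) \<le> \<epsilon> + (1 - \<epsilon>) * of_bool (real (card Z) < s)"
        using acc[of Z] quantum_acceptance_bounds[OF fin Q] by (cases "real (card Z) < s") auto
      then have "bernoulli_weight S x Z * ?F (\<lambda>r. r \<in> Z)
          \<le> bernoulli_weight S x Z * (\<epsilon> + (1 - \<epsilon>) * of_bool (real (card Z) < s))"
        using bernoulli_weight_nonneg[OF x01] by (intro mult_left_mono) auto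
      then show "bernoulli_weight S x Z * ?F (\<lambda>r. r \<in> Z) \<le> \<epsilon> * bernoulli_weight S x Z
        + (1 - \<epsilon>) * (bernoulli_weight S x Z * of_bool (real (card Z) < s))"
        by (simp add: algebra_simps)
    qed
    also have "\<dots> = \<epsilon> + (1 - \<epsilon>) * lower_tail S s x"
      by (simp only: sum.distrib lower_tail_def flip: sum_distrib_left) (simp add: sum_bernoulli_weight fin)
    also have "\<dots> \<le> \<epsilon> + (1 - \<epsilon>) * b" using tail[OF x] \<epsilon> by (simp add: mult_left_mono)
    finally show ?thesis .
  qed
  from norm_poly_zero_le_of_bound_on_interval[OF p(1) y this]
  have "cmod (poly p 0) \<le> (\<epsilon> + (1 - \<epsilon>) * b) * ((1 + sqrt y) / (1 - sqrt y)) ^ (2 * calls Q)" .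
  moreover have "poly p 0 = 1"
  proof -
    have "bernoulli_weight S 0 Z = of_bool (Z = {})" if "Z \<in> Pow S" for Z
      using that fin finite_subset[of Z S] by (auto simp: bernoulli_weight_def card_gt_0_iff power_0_left)
    then have "(\<Sum>Z\<in>Pow S. bernoulli_weight S 0 Z * ?F (\<lambda>r. r \<in> Z))
      = (\<Sum>Z\<in>Pow S. if Z = {} then ?F (\<lambda>r. r \<in> Z) else 0)"
      by (intro sum.cong refl) auto
    also have "\<dots> = 1" using fin rej by (simp add: sum.delta)
    finally show ?thesis using p_eq[of 0] by simp
  qed
  ultimately show ?thesis by simp
qed

section \<open>Necessary calls\<close>

definition state_norm :: "'b set \<Rightarrow> ('b \<Rightarrow> complex) \<Rightarrow> real" where
  "state_norm B \<psi> = L2_set (\<lambda>i. cmod (\<psi> i)) B"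

lemma state_norm_triangle: "state_norm B (\<lambda>i. \<phi> i + \<psi> i) \<le> state_norm B \<phi> + state_norm B \<psi>"
  unfolding state_norm_def
  by (rule order_trans[OF L2_set_mono L2_set_triangle_ineq]) (simp_all add: norm_triangle_ineq)

lemma state_norm_minus: "state_norm B (\<lambda>i. - \<psi> i) = state_norm B \<psi>"
  by (simp add: state_norm_def)

lemma state_norm_query_gate: "state_norm (basis S m) (query_gate z \<psi>) = state_norm (basis S m) \<psi>"
  unfolding state_norm_def L2_set_def by (simp only: sum_basis_query_gate[of "\<lambda>x. (cmod x)\<^sup>2"])

text \<open>
  Hybrid argument: only the amplitude that the run on the empty black box puts on \<open>r\<close> can reveal
  that \<open>r\<close> has been marked.
\<close>

lemma state_after_marked_dist:
  assumes fin: "finite S" and Q: "query_alg S Q" and k: "k \<le> calls Q"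
  defines "B \<equiv> basis S (workspace Q)" and "\<psi> \<equiv> state_after S Q (\<lambda>_. False)"
  shows "state_norm B (\<lambda>i. state_after S Q (\<lambda>r'. r' = r) k i - \<psi> k i)
    \<le> 2 * (\<Sum>j<k. state_norm B (\<lambda>i. if fst i = r then \<psi> j i else 0))"
  using k
proof (induction k)
  case 0
  then show ?case by (simp add: state_norm_def \<psi>_def L2_set_def)
next
  case (Suc k)
  let ?z = "\<lambda>r'. r' = r" and ?P = "\<lambda>i. if fst i = r then \<psi> k i else 0"
  let ?\<phi> = "state_after S Q ?z k"
  have U: "unitary_on B (gate Q (Suc k))" using Q Suc.prems by (simp add: query_alg_def B_def)
  have "state_norm B (\<lambda>i. state_after S Q ?z (Suc k) i - \<psi> (Suc k) i)
    = state_norm B (apply_op B (gate Q (Suc k)) (\<lambda>i. query_gate ?z ?\<phi> i - query_gate (\<lambda>_. False) (\<psi> k) i))"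
    by (simp add: \<psi>_def B_def apply_op_diff)
  also have "\<dots> = state_norm B (\<lambda>i. query_gate ?z ?\<phi> i - query_gate (\<lambda>_. False) (\<psi> k) i)"
    using unitary_on_norm_sum[OF _ U] finite_basis[OF fin] by (simp add: state_norm_def L2_set_def B_def)
  \<comment> \<open>The two oracles differ only at \<open>r\<close>: besides the queried old
    difference there remains the part of \<open>\<psi> k\<close> at \<open>r\<close>, once queried
    and once not, which gives the factor 2.\<close>
  also have "(\<lambda>i. query_gate ?z ?\<phi> i - query_gate (\<lambda>_. False) (\<psi> k) i)
    = (\<lambda>i. query_gate ?z (\<lambda>i. ?\<phi> i - \<psi> k i) i + (query_gate ?z ?P i + - ?P i))"
    by (auto simp: query_gate_def fun_eq_iff)
  also have "state_norm B \<dots> \<le> state_norm B (query_gate ?z (\<lambda>i. ?\<phi> i - \<psi> k i))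
      + (state_norm B (query_gate ?z ?P) + state_norm B (\<lambda>i. - ?P i))"
    by (intro order_trans[OF state_norm_triangle] add_left_mono state_norm_triangle)
  also have "\<dots> = state_norm B (\<lambda>i. ?\<phi> i - \<psi> k i) + 2 * state_norm B ?P"
    unfolding B_def state_norm_query_gate state_norm_minus by simp
  finally show ?case using Suc by simp
qed

text \<open>The \<open>T\<close> unit states of the unmarked run spread total weight
  \<open>T\<close> over the N samples, so some \<open>r\<close> receives at most T/N, and
  Cauchy-Schwarz bounds the distance between the two runs. Accepting amplitudes of the unmarked run
  vanish exactly, so the acceptance probability is at most the squared distance.\<close>

lemma ex_marked_element_hard:
  assumes fin: "finite S" and ne: "S \<noteq> {}" and Q: "query_alg S Q"
    and rej: "quantum_acceptance S Q (\<lambda>_. False) = 0"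
  shows "\<exists>r\<in>S. quantum_acceptance S Q (\<lambda>r'. r' = r) \<le> 4 * (real (calls Q))\<^sup>2 / real (card S)"
proof -
  define B where "B = basis S (workspace Q)"
  define \<psi> where "\<psi> = state_after S Q (\<lambda>_. False)"
  define T where "T = calls Q"
  define w where "w r k = state_norm B (\<lambda>i. if fst i = r then \<psi> k i else 0)" for r k
  have finB: "finite B" using finite_basis[OF fin] by (simp add: B_def)
  have n: "real (card S) > 0" using fin ne by (simp add: card_gt_0_iff)
  have w_sq: "(w r k)\<^sup>2 = (\<Sum>i\<in>B. if fst i = r then (cmod (\<psi> k i))\<^sup>2 else 0)" for r k
    unfolding w_def state_norm_def L2_set_def
    by (simp add: sum_nonneg if_distrib[of cmod] if_distrib[of "\<lambda>x. x\<^sup>2"] cong: if_cong)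
  have total: "(\<Sum>r\<in>S. (w r k)\<^sup>2) = 1" if "k \<le> T" for k
  proof -
    have "(\<Sum>r\<in>S. (w r k)\<^sup>2) = (\<Sum>i\<in>B. \<Sum>r\<in>S. if fst i = r then (cmod (\<psi> k i))\<^sup>2 else 0)"
      unfolding w_sq by (rule sum.swap)
    also have "\<dots> = (\<Sum>i\<in>B. (cmod (\<psi> k i))\<^sup>2)"
      using fin by (intro sum.cong refl) (auto simp: B_def basis_def)
    also have "\<dots> = 1" using state_after_norm[OF fin Q, of k] that by (simp add: B_def \<psi>_def T_def)
    finally show ?thesis .
  qed
  have "\<exists>r\<in>S. (\<Sum>k<T. (w r k)\<^sup>2) \<le> real T / real (card S)"
  proof (rule ccontr)
    assume "\<not> ?thesis"
    then have "(\<Sum>r\<in>S. real T / real (card S)) < (\<Sum>r\<in>S. \<Sum>k<T. (w r k)\<^sup>2)"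
      using fin ne by (intro sum_strict_mono) (auto simp: not_le)
    also have "\<dots> = (\<Sum>k<T. \<Sum>r\<in>S. (w r k)\<^sup>2)" by (rule sum.swap)
    also have "\<dots> = real T" using total by simp
    finally show False using n by simp
  qed
  then obtain r where r: "r \<in> S" "(\<Sum>k<T. (w r k)\<^sup>2) \<le> real T / real (card S)" by blast
  let ?\<phi> = "state_after S Q (\<lambda>r'. r' = r) T"
  have "state_norm B (\<lambda>i. ?\<phi> i - \<psi> T i) \<le> 2 * (\<Sum>k<T. w r k)"
    using state_after_marked_dist[OF fin Q, of T r] unfolding w_def B_def \<psi>_def T_def by simp
  moreover have "0 \<le> state_norm B (\<lambda>i. ?\<phi> i - \<psi> T i)" by (simp add: state_norm_def)
  ultimately have "(state_norm B (\<lambda>i. ?\<phi> i - \<psi> T i))\<^sup>2 \<le> (2 * (\<Sum>k<T. w r k))\<^sup>2"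
    by (intro power_mono)
  also have "\<dots> = 4 * (\<Sum>k<T. w r k)\<^sup>2" by (simp add: power_mult_distrib)
  also have "(\<Sum>k<T. w r k)\<^sup>2 \<le> (\<Sum>k<T. (w r k)\<^sup>2) * real (card {..<T})"
    by (rule sum_squared_le_sum_of_squares)
  also have "\<dots> \<le> real T / real (card S) * real T"
    using mult_right_mono[OF r(2), of "real T"] by simp
  finally have dist: "(state_norm B (\<lambda>i. ?\<phi> i - \<psi> T i))\<^sup>2 \<le> 4 * (real T)\<^sup>2 / real (card S)"
    by (simp add: power2_eq_square)
  have acc: "accepting Q \<subseteq> B" using Q by (simp add: query_alg_def B_def)
  have zero: "\<psi> T i = 0" if "i \<in> accepting Q" for i
    using rej that finite_subset[OF acc finB]
    by (simp add: quantum_acceptance_def \<psi>_def T_def sum_nonneg_eq_0_iff)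
  have "quantum_acceptance S Q (\<lambda>r'. r' = r) = (\<Sum>i\<in>accepting Q. (cmod (?\<phi> i - \<psi> T i))\<^sup>2)"
    unfolding quantum_acceptance_def T_def[symmetric] using zero by (intro sum.cong) auto
  also have "\<dots> \<le> (\<Sum>i\<in>B. (cmod (?\<phi> i - \<psi> T i))\<^sup>2)"
    using acc finB by (intro sum_mono2) auto
  also have "\<dots> = (state_norm B (\<lambda>i. ?\<phi> i - \<psi> T i))\<^sup>2"
    by (simp add: state_norm_def L2_set_def sum_nonneg)
  also note dist
  finally show ?thesis using r(1) by (auto simp: T_def)
qed

text \<open>Black boxes that ignore \<open>x\<close> turn the task into one about marked sets
  \<open>Z\<close>.\<close>

lemma calls_suffice_promise:
  fixes q \<epsilon> :: real
  assumes fin: "finite S" and ne: "S \<noteq> {}" and cs: "calls_suffice n S q \<epsilon> T"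
  shows "\<exists>Q. query_alg S Q \<and> calls Q = T \<and> quantum_acceptance S Q (\<lambda>_. False) = 0 \<and>
    (\<forall>Z\<subseteq>S. q * real (card S) \<le> real (card Z) \<longrightarrow> 1 - \<epsilon> \<le> quantum_acceptance S Q (\<lambda>r. r \<in> Z))"
proof -
  have n: "real (card S) > 0" using fin ne by (simp add: card_gt_0_iff)
  obtain Q where Q: "query_alg S Q" "calls Q = T"
    and comp: "\<And>A f. pq_computes 0 q n (classical_acceptance S A) f \<Longrightarrow>
              pq_computes 0 (1 - \<epsilon>) n (\<lambda>x. quantum_acceptance S Q (A x)) f"
    using cs unfolding calls_suffice_def by blast
  have len: "length (replicate n True) = n" by simp
  have "quantum_acceptance S Q (\<lambda>_. False) \<le> 0"
    using comp[of "\<lambda>_ _. False" "\<lambda>_. False"] len unfolding pq_computes_def classical_acceptance_def by fastforce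
  then have "quantum_acceptance S Q (\<lambda>_. False) = 0"
    using quantum_acceptance_bounds(1)[OF fin Q(1), of "\<lambda>_. False"] by linarith
  moreover have "1 - \<epsilon> \<le> quantum_acceptance S Q (\<lambda>r. r \<in> Z)"
    if Z: "Z \<subseteq> S" "q * real (card S) \<le> real (card Z)" for Z
  proof -
    have "{r \<in> S. r \<in> Z} = Z" using Z by auto
    then have "pq_computes 0 q n (classical_acceptance S (\<lambda>_ r. r \<in> Z)) (\<lambda>_. True)"
      using Z(2) n by (simp add: pq_computes_def classical_acceptance_def field_simps)
    from comp[OF this] len show ?thesis unfolding pq_computes_def by blast
  qed
  ultimately show ?thesis using Q by blast
qed

text \<open>The mean \<open>x\<close> lies above the threshold \<eta>, so the moment bound per
  sample can be brought below 1: by ln t \<le> t - 1 its logarithm is at most (1 - a)(\<eta>/a -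
  x).\<close>

lemma chernoff_base_less_1:
  fixes \<eta> x :: real
  assumes "0 < \<eta>" "\<eta> < x" "x < 1"
  shows "\<exists>a. 0 < a \<and> a < 1 \<and> a powr (- \<eta>) * (1 - x * (1 - a)) < 1"
proof -
  \<comment> \<open>Chosen so that \<open>\<eta> / a\<close> is the midpoint of \<eta> and
    \<open>x\<close>.\<close>
  define a where "a = 2 * \<eta> / (\<eta> + x)"
  have a: "0 < a" "a < 1" using assms by (auto simp: a_def field_simps)
  have pos: "0 < 1 - x * (1 - a)"
  proof -
    have "x * (1 - a) \<le> 1 * (1 - a)" using assms a by (intro mult_right_mono) auto
    also have "\<dots> < 1" using a by simp
    finally show ?thesis by (simp only: diff_gt_0_iff_gt)
  qed
  have "ln (a powr (- \<eta>) * (1 - x * (1 - a))) = \<eta> * ln (1 / a) + ln (1 - x * (1 - a))"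
    using a pos by (simp add: ln_mult ln_powr ln_div)
  also have "\<dots> \<le> \<eta> * (1 / a - 1) + (- (x * (1 - a)))"
    using assms a pos ln_le_minus_one[of "1 / a"] ln_le_minus_one[of "1 - x * (1 - a)"]
    by (intro add_mono mult_left_mono) auto
  also have "\<dots> = (1 - a) * (\<eta> / a - x)" using a by (simp add: field_simps)
  also have "\<eta> / a = (\<eta> + x) / 2" using assms by (simp add: a_def field_simps)
  also have "(1 - a) * ((\<eta> + x) / 2 - x) < 0" using a assms by (intro mult_pos_neg) auto
  finally have "a powr (- \<eta>) * (1 - x * (1 - a)) < 1"
    using a pos by (simp add: ln_less_zero_iff)
  then show ?thesis using a by blast
qed

text \<open>As \<eta> < 1, there is room for a marking probability \<open>x1\<close> strictly
  between \<eta> and 1. There the lower tail decays like \<gamma>^N while \<open>1 - sqrt x1\<close>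
  stays positive; all constants derive from these two facts.\<close>

lemma necessary_calls:
  fixes \<eta> :: real
  assumes \<eta>: "0 < \<eta>" "\<eta> < 1"
  shows "\<exists>c>0. \<forall>n (S :: 'r set) q \<epsilon> T. finite S \<and> S \<noteq> {} \<and> 0 < q \<and> q \<le> \<eta> \<and>
    1 / 2 ^ card S \<le> \<epsilon> \<and> \<epsilon> < 1 \<and> calls_suffice n S q \<epsilon> T \<longrightarrow>
    c * amplification_bound (real (card S)) q \<epsilon> \<le> real T"
proof -
  define x1 where "x1 = (1 + \<eta>) / 2"
  have x1: "\<eta> < x1" "0 < x1" "x1 < 1" using \<eta> by (auto simp: x1_def)
  obtain a where a: "0 < a" "a < 1" "a powr (- \<eta>) * (1 - x1 * (1 - a)) < 1"
    using chernoff_base_less_1[OF \<eta>(1) x1(1,3)] by blast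
  define \<gamma> where "\<gamma> = a powr (- \<eta>) * (1 - x1 * (1 - a))"
  have "x1 * (1 - a) < 1 * 1" using x1 a by (intro mult_strict_mono) auto
  then have \<gamma>: "0 < \<gamma>" "\<gamma> < 1" using a by (auto simp: \<gamma>_def)
  define \<beta> where "\<beta> = - log 2 \<gamma>"
  have \<beta>: "0 < \<beta>" "\<gamma> = 2 powr (- \<beta>)" using \<gamma> by (auto simp: \<beta>_def)
  \<comment> \<open>A lower bound for the share of \<open>L\<close> that survives when it is capped
    at \<open>\<beta> * N / 2\<close> in the main case.\<close>
  define \<kappa> where "\<kappa> = min 1 (\<beta> / 2)"
  have \<kappa>: "0 < \<kappa>" "\<kappa> \<le> 1" "\<kappa> \<le> \<beta> / 2" using \<beta> by (auto simp: \<kappa>_def)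
  have sx1: "0 < 1 - sqrt x1" using x1 by simp
  \<comment> \<open>The 32 collects the factors 4 and 8 at the end of the main case.\<close>
  define c where "c = \<kappa> * (1 - sqrt x1) / 32"
  have c0: "0 < c" using \<kappa> sx1 by (simp add: c_def)
  have c\<kappa>: "c \<le> \<kappa> / 32"
  proof -
    have "\<kappa> * (1 - sqrt x1) \<le> \<kappa> * 1" using \<kappa> x1 by (intro mult_left_mono) auto
    then show ?thesis by (simp add: c_def)
  qed
  have "c * amplification_bound (real (card S)) q \<epsilon> \<le> real T"
    if fin: "finite S" and ne: "S \<noteq> {}" and q: "0 < q" "q \<le> \<eta>"
      and \<epsilon>: "1 / 2 ^ card S \<le> \<epsilon>" "\<epsilon> < 1" and cs: "calls_suffice n S q \<epsilon> T"
    for n and S :: "'r set" and q \<epsilon> :: real and T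
  proof -
    define N where "N = real (card S)"
    define L where "L = log 2 (1 / \<epsilon>)"
    define s where "s = q * N"
    define B where "B = amplification_bound N q \<epsilon>"
    have N: "1 \<le> N" using fin ne by (simp add: N_def Suc_le_eq card_gt_0_iff)
    have "(0 :: real) < 1 / 2 ^ card S" by simp
    then have \<epsilon>0: "0 < \<epsilon>" using \<epsilon> by linarith
    have L: "0 < L" using \<epsilon> \<epsilon>0 by (simp add: L_def)
    have \<epsilon>_eq: "\<epsilon> = 2 powr (- L)" using \<epsilon>0 by (simp add: L_def log_divide)
    have LN: "L \<le> N"
    proof -
      have "2 powr (- N) \<le> 2 powr (- L)"
        using \<epsilon>(1) by (simp add: \<epsilon>_eq N_def powr_minus powr_realpow divide_inverse)
      then show ?thesis by simp
    qed
    have s: "0 < s" "s \<le> \<eta> * N" using q N by (auto simp: s_def)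
    have B_eq: "B = sqrt N * L / (sqrt (L + s) + sqrt s)"
      unfolding B_def L_def s_def using L q N by (intro amplification_bound_eq) (auto simp: L_def)
    have B_le: "B \<le> sqrt N * L / sqrt (L + s)"
      unfolding B_eq using L s N by (intro divide_left_mono mult_pos_pos add_pos_pos) auto
    have B_le': "B \<le> sqrt (N * L)"
    proof -
      have "sqrt N * L / sqrt (L + s) \<le> sqrt N * L / sqrt L"
        using L s N by (intro divide_left_mono) auto
      also have "\<dots> = sqrt (N * L)" using L by (simp add: real_sqrt_mult real_div_sqrt flip: times_divide_eq_right)
      finally show ?thesis using B_le by simp
    qed
    have B0: "0 \<le> B" unfolding B_eq using L s N by simp
    obtain Q where Q: "query_alg S Q" "calls Q = T" "quantum_acceptance S Q (\<lambda>_. False) = 0"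
      and acc: "\<And>Z. Z \<subseteq> S \<Longrightarrow> s \<le> real (card Z) \<Longrightarrow> 1 - \<epsilon> \<le> quantum_acceptance S Q (\<lambda>r. r \<in> Z)"
      using calls_suffice_promise[OF fin ne cs] unfolding s_def N_def by blast
    \<comment> \<open>Without queries the output cannot depend on the black box, although the empty
      and the full marked set require different answers.\<close>
    have "T \<noteq> 0"
    proof
      assume "T = 0"
      then have "quantum_acceptance S Q (\<lambda>r. r \<in> S) = quantum_acceptance S Q (\<lambda>_. False)"
        using Q(2) by (simp add: quantum_acceptance_def)
      moreover have "s \<le> real (card S)" using mult_right_mono[of q 1 N] q \<eta> N by (simp add: s_def N_def)
      ultimately show False using acc[of S] Q(3) \<epsilon>(2) by simp
    qed
    then have T1: "1 \<le> real T" by simp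
    \<comment> \<open>For bounded \<open>N\<close> a single call already meets the bound. If
      \<open>s + L < 1\<close>, one marked sample must be accepted and the hybrid argument applies.
      Otherwise \<open>s + L\<close> absorbs the additive 1 in the definition of
      \<open>y\<close>.\<close>
    consider (small) "\<beta> * N < 2" | (few) "2 \<le> \<beta> * N" "s + L < 1" | (main) "2 \<le> \<beta> * N" "1 \<le> s + L"
      by linarith
    then have "c * B \<le> real T"
    proof cases
      case small
      have "sqrt (N * L) \<le> sqrt (N * N)"
        using LN N by (intro real_sqrt_le_mono mult_left_mono) auto
      then have "B \<le> N" using B_le' N by simp
      then have "c * B \<le> \<beta> / 2 * N" using c\<kappa> \<kappa> N B0 by (intro mult_mono) auto
      then show ?thesis using small T1 by linarith
    next
      case few
      obtain r where r: "r \<in> S" "quantum_acceptance S Q (\<lambda>r'. r' = r) \<le> 4 * (real T)\<^sup>2 / N"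
        using ex_marked_element_hard[OF fin ne Q(1,3)] unfolding Q(2) N_def by blast
      have "1 - \<epsilon> \<le> quantum_acceptance S Q (\<lambda>r'. r' = r)"
        using acc[of "{r}"] r(1) few L by simp
      then have "1 - \<epsilon> \<le> 4 * (real T)\<^sup>2 / N" using r(2) by linarith
      then have T2: "(1 - \<epsilon>) * N \<le> 4 * (real T)\<^sup>2" using N by (simp add: field_simps)
      \<comment> \<open>With \<epsilon> = exp(-u) and u \<le> 1, the quantity 1 - \<epsilon> is at
        least u/(1 + u), hence at least u/2.\<close>
      have "L / 4 \<le> 1 - \<epsilon>"
      proof -
        have ln2: "1 / 2 \<le> ln (2 :: real)" "ln (2 :: real) \<le> 1" using ln2_ge_two_thirds ln_le_minus_one[of 2] by auto
        define u where "u = L * ln 2"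
        have "L * (1 / 2) \<le> u" "u \<le> 1 * 1"
          unfolding u_def using L s few ln2 by (intro mult_left_mono mult_mono; simp)+
        then have u: "0 < u" "u \<le> 1" "L / 2 \<le> u" using L by auto
        have "1 + u \<le> exp u" by (rule exp_ge_add_one_self)
        then have "\<epsilon> * (1 + u) \<le> \<epsilon> * exp u" using \<epsilon>0 by (intro mult_left_mono) auto
        also have "\<dots> = 1" by (simp add: \<epsilon>_eq powr_def u_def flip: exp_add)
        finally have "u \<le> (1 - \<epsilon>) * (1 + u)" by (simp add: algebra_simps)
        also have "\<dots> \<le> (1 - \<epsilon>) * 2" using u \<epsilon> by (intro mult_left_mono) auto
        finally show ?thesis using u by simp
      qed
      then have "L / 4 * N \<le> (1 - \<epsilon>) * N" using N by (intro mult_right_mono) auto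
      then have "N * L \<le> (4 * real T)\<^sup>2" using T2 by (simp add: power_mult_distrib field_simps)
      then have "sqrt (N * L) \<le> 4 * real T" by (intro real_le_lsqrt) auto
      then have "B \<le> 4 * real T" using B_le' by linarith
      moreover have "c * B \<le> 1 / 32 * B" using c\<kappa> \<kappa> B0 by (intro mult_right_mono) auto
      ultimately show ?thesis by simp
    next
      case main
      \<comment> \<open>The target error is weakened to \<epsilon>' so that the tail bound
        2^(-\<beta> N) available at \<open>x1\<close> is at most \<epsilon>'/2.\<close>
      define L' where "L' = min L (\<beta> * N / 2)"
      define \<epsilon>' where "\<epsilon>' = 2 powr (- L')"
      \<comment> \<open>From the first value on, the moment bound with base 1/2 makes the tail at
        most \<epsilon>'/2; the cap \<open>x1\<close> keeps \<open>1 - sqrt y\<close> away from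
        0.\<close>
      define y where "y = min (2 * (s + L' + 1) / N) x1"
      have L': "0 < L'" "L' \<le> L" "L' + 1 \<le> \<beta> * N" using L \<beta> N main by (auto simp: L'_def)
      have \<kappa>L: "\<kappa> * L \<le> L'"
      proof -
        have "\<kappa> * L \<le> 1 * L" "\<kappa> * L \<le> \<beta> / 2 * N"
          using \<kappa> L LN by (intro mult_mono; simp)+
        then show ?thesis by (simp add: L'_def)
      qed
      have \<epsilon>': "0 < \<epsilon>'" "\<epsilon>' < 1" "\<epsilon> \<le> \<epsilon>'" using L' by (auto simp: \<epsilon>'_def \<epsilon>_eq powr_less_one)
      have half: "2 powr (- (L' + 1)) = \<epsilon>' / 2" by (simp add: \<epsilon>'_def powr_diff)
      have y: "0 < y" "y < 1" "y \<le> x1" "y \<le> 2 * (s + L' + 1) / N"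
        using s L' N x1 by (auto simp: y_def min_less_iff_disj)
      have tail: "lower_tail S s x \<le> \<epsilon>' / 2" if x: "y \<le> x" "x \<le> 1" for x
      proof (cases "x1 \<le> 2 * (s + L' + 1) / N")
        case True
        then have x1x: "x1 \<le> x" using x by (simp add: y_def)
        have "lower_tail S s x \<le> a powr (- s) * (1 - x * (1 - a)) ^ card S"
          using a x y by (intro lower_tail_le fin) auto
        also have "\<dots> \<le> a powr (- (\<eta> * N)) * (1 - x1 * (1 - a)) ^ card S"
        proof (intro mult_mono power_mono)
          show "a powr (- s) \<le> a powr (- (\<eta> * N))" using a s by (intro powr_mono') auto
          show "1 - x * (1 - a) \<le> 1 - x1 * (1 - a)" using x1x a by (simp add: mult_right_mono)
          have "x * (1 - a) \<le> 1 * 1" using x y a by (intro mult_mono) auto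
          then show "0 \<le> 1 - x * (1 - a)" by (simp only: mult_1_left diff_ge_0_iff_ge)
          then show "0 \<le> (1 - x * (1 - a)) ^ card S" by simp
        qed simp
        also have "\<dots> = \<gamma> ^ card S"
          using a by (simp add: \<gamma>_def power_mult_distrib N_def powr_powr flip: powr_realpow)
        also have "\<dots> = 2 powr (- (\<beta> * N))"
          by (simp add: \<beta>(2) N_def powr_powr flip: powr_realpow)
        also have "\<dots> \<le> 2 powr (- (L' + 1))" using L' by simp
        finally show ?thesis unfolding half .
      next
        case False
        then have xN: "2 * (s + L' + 1) \<le> x * N" using x N by (simp add: y_def field_simps)
        have x0: "0 < x" using x y by simp
        have "lower_tail S s x \<le> (1 / 2) powr (- s) * (1 - x * (1 - 1 / 2)) ^ card S"
          using x x0 by (intro lower_tail_le fin) auto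
        also have "(1 - x * (1 - 1 / 2)) ^ card S \<le> exp (- (x / 2)) ^ card S"
          using exp_ge_add_one_self[of "- (x / 2)"] x by (intro power_mono) auto
        also have "\<dots> = exp (- (x * N / 2))" by (simp add: N_def exp_of_nat_mult[symmetric] mult_ac)
        also have "\<dots> \<le> exp (- (s + L' + 1))" using xN by simp
        also have "\<dots> \<le> 2 powr (- (s + L' + 1))"
        proof -
          have "(s + L' + 1) * ln 2 \<le> (s + L' + 1) * 1"
            using ln_le_minus_one[of "2 :: real"] s L' by (intro mult_left_mono) auto
          then show ?thesis by (simp add: powr_def algebra_simps)
        qed
        also have "(1 / 2) powr (- s) * 2 powr (- (s + L' + 1)) = 2 powr (- (L' + 1))"
          by (simp add: powr_divide powr_minus_divide flip: powr_add)
        finally show ?thesis unfolding half by simp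
      qed
      define u where "u = sqrt y"
      have u: "0 < u" "u < 1" "u \<le> sqrt x1" using y by (auto simp: u_def)
      define G where "G = (1 + u) / (1 - u)"
      have G: "0 < G" using u by (simp add: G_def)
      define M where "M = \<epsilon>' + (1 - \<epsilon>') * (\<epsilon>' / 2)"
      have M: "M = \<epsilon>' * (1 + (1 - \<epsilon>') / 2)" by (simp add: M_def algebra_simps)
      have M0: "0 < M" unfolding M using \<epsilon>' by (intro mult_pos_pos add_pos_pos) auto
      have "1 \<le> M * G ^ (2 * T)"
        unfolding M_def G_def u_def Q(2)[symmetric]
      proof (rule one_le_error_times_growth[OF fin Q(1) _ _ Q(3) _ y(1,2) tail])
        show "1 - \<epsilon>' \<le> quantum_acceptance S Q (\<lambda>r. r \<in> Z)" if "Z \<subseteq> S" "s \<le> real (card Z)" for Z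
          using acc[OF that] \<epsilon>' by linarith
      qed (use \<epsilon>' in auto)
      then have "0 \<le> ln (M * G ^ (2 * T))" by simp
      also have "\<dots> = ln M + real (2 * T) * ln G" using M0 G by (simp add: ln_mult ln_realpow)
      also have "ln M = ln \<epsilon>' + ln (1 + (1 - \<epsilon>') / 2)" unfolding M
        using \<epsilon>' by (intro ln_mult_pos add_pos_pos) auto
      finally have growth: "0 \<le> ln \<epsilon>' + ln (1 + (1 - \<epsilon>') / 2) + real (2 * T) * ln G" .
      \<comment> \<open>Since 1 - \<epsilon>' is at most -ln \<epsilon>', the tail term consumes at
        most half of -ln \<epsilon>', even for \<epsilon>' near 1.\<close>
      have "ln (1 + (1 - \<epsilon>') / 2) \<le> (1 - \<epsilon>') / 2" using \<epsilon>' by (intro ln_add_one_self_le_self) auto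
      moreover have "ln \<epsilon>' \<le> \<epsilon>' - 1" using \<epsilon>' by (intro ln_le_minus_one) auto
      moreover have "ln \<epsilon>' = - (L' * ln 2)" by (simp add: \<epsilon>'_def ln_powr)
      ultimately have "L' * ln 2 / 2 \<le> real (2 * T) * ln G" using growth by argo
      moreover have "L' * (1 / 2) \<le> L' * ln 2"
        using L' ln2_ge_two_thirds by (intro mult_left_mono) auto
      ultimately have "L' / 4 \<le> real (2 * T) * ln G" by linarith
      also have "\<dots> \<le> real (2 * T) * (2 * u / (1 - sqrt x1))"
      proof (intro mult_left_mono)
        have "ln G \<le> G - 1" using G by (rule ln_le_minus_one)
        also have "\<dots> = 2 * u / (1 - u)" using u by (simp add: G_def field_simps)
        also have "\<dots> \<le> 2 * u / (1 - sqrt x1)" using u sx1 by (intro divide_left_mono mult_pos_pos) linarith+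
        finally show "ln G \<le> 2 * u / (1 - sqrt x1)" .
      qed simp
      also have "\<dots> \<le> real (2 * T) * (2 * (2 * sqrt ((L + s) / N)) / (1 - sqrt x1))"
      proof -
        have "y \<le> 4 * ((L + s) / N)"
        proof -
          have "2 * (s + L' + 1) / N \<le> 4 * (L + s) / N"
            using L' main N by (intro divide_right_mono) auto
          then show ?thesis using y(4) by simp
        qed
        then have "u \<le> sqrt (4 * ((L + s) / N))" unfolding u_def by (rule real_sqrt_le_mono)
        also have "\<dots> = 2 * sqrt ((L + s) / N)" by (subst real_sqrt_mult) simp
        finally have "u \<le> 2 * sqrt ((L + s) / N)" .
        then show ?thesis using sx1 by (intro mult_left_mono divide_right_mono) auto
      qed
      also have "\<dots> = 8 * real T * sqrt ((L + s) / N) / (1 - sqrt x1)" by simp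
      finally have "L' * (1 - sqrt x1) \<le> 32 * (real T * sqrt ((L + s) / N))"
        using sx1 by (simp add: field_simps)
      moreover have "\<kappa> * L * (1 - sqrt x1) \<le> L' * (1 - sqrt x1)"
        using \<kappa>L sx1 by (intro mult_right_mono) auto
      ultimately have "c * L \<le> real T * sqrt ((L + s) / N)" by (simp add: c_def field_simps)
      then have "c * (sqrt N * L / sqrt (L + s)) \<le> real T"
        using N L s by (simp add: real_sqrt_divide field_simps)
      moreover have "c * B \<le> c * (sqrt N * L / sqrt (L + s))" using B_le c0 by (intro mult_left_mono) auto
      ultimately show ?thesis by linarith
    qed
    then show ?thesis by (simp add: B_def N_def)
  qed
  then show ?thesis using c0 by blast
qed

text \<open>The constants depend on \<eta> and \<delta> because neither bound is uniform up to 1.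
  For q = 1 a single query at a fixed sample decides, while the formula grows linearly in N at
  \<epsilon> = 2^(-N). As \<epsilon> tends to 1 the formula tends to 0, while at least one call
  remains necessary.\<close>

theorem theorem1:
  fixes \<eta> \<delta> :: real
  assumes "0 < \<eta>" "\<eta> < 1" and "0 < \<delta>" "\<delta> < 1"
  shows "\<exists>c>0. \<exists>C>0. \<forall>(n::nat) (S::nat set) (q::real) (\<epsilon>::real).
    finite S \<and> S \<noteq> {} \<and> 0 < q \<and> q \<le> 1 \<and> 1 / 2 ^ card S \<le> \<epsilon> \<and> \<epsilon> < 1 \<longrightarrow>
      (q \<le> \<eta> \<longrightarrow>
        (\<forall>T. calls_suffice n S q \<epsilon> T \<longrightarrow> c * amplification_bound (real (card S)) q \<epsilon> \<le> real T)) \<and>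
      (\<epsilon> \<le> \<delta> \<longrightarrow>
        (\<exists>T. calls_suffice n S q \<epsilon> T \<and> real T \<le> C * amplification_bound (real (card S)) q \<epsilon>))"
proof -
  obtain c where c: "0 < c" "\<And>n (S :: nat set) q \<epsilon> T. finite S \<and> S \<noteq> {} \<and> 0 < q \<and> q \<le> \<eta> \<and>
    1 / 2 ^ card S \<le> \<epsilon> \<and> \<epsilon> < 1 \<and> calls_suffice n S q \<epsilon> T \<Longrightarrow>
    c * amplification_bound (real (card S)) q \<epsilon> \<le> real T"
    using necessary_calls[OF assms(1,2), where 'r = nat] by blast
  define C where "C = 12 * (2 + 1 / log 2 (1 / \<delta>))"
  have "0 < log 2 (1 / \<delta>)" using assms(3,4) by simp
  then have C: "0 < C" by (simp add: C_def add_pos_pos)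
  show ?thesis
  proof (rule exI[of _ c], rule conjI[OF c(1)], rule exI[of _ C], rule conjI[OF C], intro allI impI, elim conjE, rule conjI)
    fix n and S :: "nat set" and q \<epsilon> :: real
    assume S: "finite S" "S \<noteq> {}" and q: "0 < q" "q \<le> 1" and \<epsilon>: "1 / 2 ^ card S \<le> \<epsilon>" "\<epsilon> < 1"
    show "q \<le> \<eta> \<longrightarrow> (\<forall>T. calls_suffice n S q \<epsilon> T \<longrightarrow>
        c * amplification_bound (real (card S)) q \<epsilon> \<le> real T)"
      using c(2)[of S q \<epsilon> n] S q(1) \<epsilon> by simp
    show "\<epsilon> \<le> \<delta> \<longrightarrow> (\<exists>T. calls_suffice n S q \<epsilon> T \<and>
        real T \<le> C * amplification_bound (real (card S)) q \<epsilon>)"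
      using sufficient_calls[OF assms(3,4) S q \<epsilon>(1), of n] unfolding C_def by simp
  qed
qed

end
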